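(* Consider the problem of computing the conformal radius $r(\Omega,0)$ of a simply-connected domain $\Omega$ with $0\in\Omega$, where the boundary of $\Omega$ is given with precision $\frac1n$ by an explicit collection of $O(n^2)$ pixels. Denote the problem of computing the conformal radius with precision $\frac{1}{n^c}$ by $\mathrm{CONF}(n,n^c)$. Then $\mathrm{MAJ}_n$ is $\mathbf{AC^0}$ reducible to $\mathrm{CONF}(n,n^c)$ for any $0<c<1/2$.
   Context: For a simply-connected domain $\Omega\subsetneq\mathbb{C}$ with $w\in\Omega$, let $\psi$ be the unique conformal map of $\Omega$ onto the unit disk with $\psi(w)=0$, $\psi'(w)>0$; the conformal radius is $r(\Omega,w)=1/\psi'(w)$. $\mathrm{MAJ}_n:\{0,1\}^n\to\{0,1\}$ is the majority problem: $\mathrm{MAJ}_n(x)=1$ if and only if the majority of the entries of $x$ are $1$. $\mathbf{AC^0}$ is the class of functions computed by families of circuits (one for each input size) of constant depth and polynomial size, with NOT gates and AND, OR gates of unbounded fan-in. A problem is $\mathbf{AC^0}$ reducible to another one if it is computed by constant-depth, polynomial-size circuits of this kind which may in addition use gates solving (polynomial-size) instances of the other problem. A bounded set $S\subset\mathbb{R}^2$ is given with precision $2^{-k}$ by pixels if one is given values $f_S(i/2^k,j/2^k)\in\{0,1\}$ at the relevant grid points ($i,j\in\mathbb{Z}$) that equal $1$ if $B((i/2^k,j/2^k),2^{-k})\cap S\ne\emptyset$, equal $0$ if $B((i/2^k,j/2^k),2\cdot 2^{-k})\cap S=\emptyset$, and are arbitrary in $\{0,1\}$ otherwise. Precision $\frac1n$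 corresponds to $n=2^k$. *)

theory Defs
  imports "HOL-Complex_Analysis.Complex_Analysis"
begin

section \<open>Search problems on bit strings\<close>

text \<open>
  A problem is a relation between instances and admissible answers. Strings without any
  admissible answer are not instances, and a solver may return anything on them.
\<close>

type_synonym problem = "bool list \<Rightarrow> bool list \<Rightarrow> bool"

definition solves :: "(bool list \<Rightarrow> bool list) \<Rightarrow> problem \<Rightarrow> bool" where
  "solves g R \<longleftrightarrow> (\<forall>x. (\<exists>y. R x y) \<longrightarrow> R x (g x))"


section \<open>Bounded-depth circuits with oracle gates\<close>

text \<open>
  A circuit with \<open>n\<close> inputs is a list of gates together with the index of its output wire.
  Wires \<open>0, \<dots>, n - 1\<close> carry the inputs and wire \<open>n + i\<close> carries the value of the
  \<open>i\<close>-th gate. \<open>Oracle_Gate ws j\<close> carries the \<open>j\<close>-th bit of the oracle's answer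
  to the string on the wires \<open>ws\<close>; an oracle gate with several outputs is thus a group
  of such gates. Answers are padded with zeros.
\<close>

datatype gate =
    Not_Gate nat
  | And_Gate "nat list"
  | Or_Gate "nat list"
  | Oracle_Gate "nat list" nat

type_synonym circuit = "gate list \<times> nat"

fun fan_in :: "gate \<Rightarrow> nat list" where
  "fan_in (Not_Gate w) = [w]"
| "fan_in (And_Gate ws) = ws"
| "fan_in (Or_Gate ws) = ws"
| "fan_in (Oracle_Gate ws j) = ws"

fun gate_value :: "(bool list \<Rightarrow> bool list) \<Rightarrow> bool list \<Rightarrow> gate \<Rightarrow> bool" where
  "gate_value g v (Not_Gate w) \<longleftrightarrow> \<not> v ! w"
| "gate_value g v (And_Gate ws) \<longleftrightarrow> (\<forall>w \<in> set ws. v ! w)"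
| "gate_value g v (Or_Gate ws) \<longleftrightarrow> (\<exists>w \<in> set ws. v ! w)"
| "gate_value g v (Oracle_Gate ws j) \<longleftrightarrow>
     (let y = g (map (\<lambda>w. v ! w) ws) in j < length y \<and> y ! j)"

definition circuit_wf :: "nat \<Rightarrow> circuit \<Rightarrow> bool" where
  "circuit_wf n C \<longleftrightarrow>
     (\<forall>i < length (fst C). \<forall>w \<in> set (fan_in (fst C ! i)). w < n + i) \<and>
     snd C < n + length (fst C)"

definition circuit_output :: "(bool list \<Rightarrow> bool list) \<Rightarrow> circuit \<Rightarrow> bool list \<Rightarrow> bool" where
  "circuit_output g C x = foldl (\<lambda>v G. v @ [gate_value g v G]) x (fst C) ! snd C"

definition circuit_depth :: "nat \<Rightarrow> circuit \<Rightarrow> nat" where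
  "circuit_depth n C =
     Max (insert 0 (set
       (foldl (\<lambda>d G. d @ [Suc (Max (insert 0 ((\<lambda>w. d ! w) ` set (fan_in G))))])
          (replicate n 0) (fst C))))"

text \<open>
  Wires are counted as well as gates, so that a circuit of polynomial size can only
  pass instances of polynomial size to the oracle.
\<close>

definition circuit_size :: "circuit \<Rightarrow> nat" where
  "circuit_size C = (\<Sum>G \<leftarrow> fst C. 1 + length (fan_in G))"

text \<open>
  The circuits form a non-uniform family and must work with every solver of the
  problem in place of the oracle gates.
\<close>

definition ac0_reducible :: "(bool list \<Rightarrow> bool) \<Rightarrow> problem \<Rightarrow> bool" where
  "ac0_reducible F R \<longleftrightarrow>
     (\<exists>(C :: nat \<Rightarrow> circuit) (d :: nat) (p :: nat poly). \<forall>n.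
        circuit_wf n (C n) \<and> circuit_depth n (C n) \<le> d \<and> circuit_size (C n) \<le> poly p n \<and>
        (\<forall>g x. solves g R \<longrightarrow> length x = n \<longrightarrow> circuit_output g (C n) x = F x))"

definition MAJ :: "bool list \<Rightarrow> bool" where
  "MAJ x \<longleftrightarrow> 2 * count_list x True > length x"


section \<open>The conformal radius problem\<close>

definition normalized_conformal_map :: "complex set \<Rightarrow> complex \<Rightarrow> (complex \<Rightarrow> complex) \<Rightarrow> bool" where
  "normalized_conformal_map \<Omega> w \<psi> \<longleftrightarrow>
     \<psi> holomorphic_on \<Omega> \<and> bij_betw \<psi> \<Omega> (ball 0 1) \<and>
     \<psi> w = 0 \<and> deriv \<psi> w \<in> \<real> \<and> Re (deriv \<psi> w) > 0"

text \<open>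
  The map is unique only as a function on \<open>\<Omega>\<close>, hence the description ranges over the radius.
\<close>

definition conformal_radius :: "complex set \<Rightarrow> complex \<Rightarrow> real" where
  "conformal_radius \<Omega> w =
     (THE r. \<exists>\<psi>. normalized_conformal_map \<Omega> w \<psi> \<and> r = 1 / Re (deriv \<psi> w))"

definition grid_point :: "nat \<Rightarrow> int \<Rightarrow> int \<Rightarrow> complex" where
  "grid_point k i j = Complex (of_int i / 2 ^ k) (of_int j / 2 ^ k)"

text \<open>
  The relevant grid points are those in the square \<open>[-M, M]\<^sup>2\<close>; with \<open>n = 2 ^ k\<close> there
  are \<open>(2 M n + 1)\<^sup>2\<close> of them, so that \<open>M\<close> accounts for the constant in \<open>O(n\<^sup>2)\<close>.
\<close>

definition given_by_pixels :: "nat \<Rightarrow> nat \<Rightarrow> complex set \<Rightarrow> (int \<Rightarrow> int \<Rightarrow> bool) \<Rightarrow> bool" where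
  "given_by_pixels M k S f \<longleftrightarrow>
     (\<forall>i \<in> {- int (M * 2 ^ k)..int (M * 2 ^ k)}. \<forall>j \<in> {- int (M * 2 ^ k)..int (M * 2 ^ k)}.
        (ball (grid_point k i j) (1 / 2 ^ k) \<inter> S \<noteq> {} \<longrightarrow> f i j) \<and>
        (ball (grid_point k i j) (2 * (1 / 2 ^ k)) \<inter> S = {} \<longrightarrow> \<not> f i j))"

text \<open>Row-major encoding of the pixels as a bit string.\<close>

definition pixel :: "nat \<Rightarrow> nat \<Rightarrow> bool list \<Rightarrow> int \<Rightarrow> int \<Rightarrow> bool" where
  "pixel M k xs i j =
     xs ! nat ((i + int (M * 2 ^ k)) * int (2 * M * 2 ^ k + 1) + (j + int (M * 2 ^ k)))"

definition admissible_domain :: "nat \<Rightarrow> complex set \<Rightarrow> bool" where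
  "admissible_domain M \<Omega> \<longleftrightarrow>
     open \<Omega> \<and> simply_connected \<Omega> \<and> 0 \<in> \<Omega> \<and> \<Omega> \<noteq> UNIV \<and>
     frontier \<Omega> \<subseteq> {z. \<bar>Re z\<bar> \<le> real M \<and> \<bar>Im z\<bar> \<le> real M}"

text \<open>
  The problem \<open>CONF(n, n\<^sup>c)\<close> for \<open>n = 2 ^ k\<close> and domains with boundary in \<open>[-M, M]\<^sup>2\<close>.
  An answer is the binary expansion, least significant bit first, of a natural number \<open>a\<close> and
  stands for the approximation \<open>a / n\<close>. The pixels do not determine \<open>\<Omega>\<close>, so the approximation
  has to be valid for every domain compatible with them. For \<open>c < 1/2\<close> and large \<open>n\<close> such an
  approximation exists, because the conformal radius is then determined up to \<open>O(n powr (-1/2))\<close>.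
\<close>

definition CONF :: "nat \<Rightarrow> real \<Rightarrow> problem" where
  "CONF M c xs ys \<longleftrightarrow>
     (\<exists>k. length xs = (2 * M * 2 ^ k + 1)\<^sup>2 \<and>
       (\<exists>\<Omega>. admissible_domain M \<Omega> \<and> given_by_pixels M k (frontier \<Omega>) (pixel M k xs)) \<and>
       (\<forall>\<Omega>. admissible_domain M \<Omega> \<and> given_by_pixels M k (frontier \<Omega>) (pixel M k xs) \<longrightarrow>
          \<bar>real (horner_sum of_bool 2 ys) / 2 ^ k - conformal_radius \<Omega> 0\<bar> \<le> 1 / (2 ^ k) powr c))"

end

theory Submission imports Defs begin

text \<open>
  Cut small dents at \<open>m\<close> well separated places of the unit circle, the \<open>i\<close>-th one exactly if the
  \<open>i\<close>-th input bit is set. The shape of a dent is (a truncation of) a Poisson kernel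
  \<open>Re h\<^sub>i\<close> with \<open>h\<^sub>i(z) = (a\<^sub>i + z) / (a\<^sub>i - z)\<close>, the pole \<open>a\<^sub>i\<close> lying just
  outside the disc: on the boundary \<open>ln |z|\<close> is then close to
  \<open>- \<delta> \<Sum> Re h\<^sub>i(z)\<close>, and the maximum principle for \<open>exp (- \<delta> \<Sum> h\<^sub>i(z)) \<psi>(z) / z\<close>,
  where \<open>\<psi>\<close> is the Riemann map, carries this over to the origin. As \<open>h\<^sub>i(0) = 1\<close>, the logarithm
  of the conformal radius is \<open>- \<delta>\<close> times the number of ones up to an error of \<open>\<delta> / 10\<close>.

  A domain with the same pixels is squeezed between two dilations of the dented disc whose factors are
  \<open>1 \<plusminus> O(1/n)\<close>, so the oracle has an admissible answer and must return the conformal radius with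
  precision \<open>n\<close> to the power \<open>-c\<close>, which is less than \<open>\<delta> / 10\<close> for a suitable \<open>n\<close> polynomial in \<open>m\<close>.
  Since the dents have disjoint supports, every pixel is a disjunction of literals, and since the answer
  takes only polynomially many values, comparing it with a threshold is a disjunctive normal form of
  polynomial size.
\<close>

section \<open>Conformal radius\<close>

lemma normalized_conformal_map_inverse:
  assumes "normalized_conformal_map \<Omega> w \<psi>" "open \<Omega>" "w \<in> \<Omega>"
  obtains g where "g holomorphic_on ball 0 1" "g ` ball 0 1 = \<Omega>"
    "\<And>z. z \<in> \<Omega> \<Longrightarrow> g (\<psi> z) = z" "\<And>u. u \<in> ball 0 1 \<Longrightarrow> \<psi> (g u) = u"
    "g 0 = w" "deriv \<psi> w * deriv g 0 = 1"
proof -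
  have hol: "\<psi> holomorphic_on \<Omega>" and bij: "bij_betw \<psi> \<Omega> (ball 0 1)" and zero: "\<psi> w = 0"
    using assms(1) by (auto simp: normalized_conformal_map_def)
  have img: "\<psi> ` \<Omega> = ball 0 1" and inj: "inj_on \<psi> \<Omega>"
    using bij by (auto simp: bij_betw_def)
  obtain g where g: "g holomorphic_on \<psi> ` \<Omega>" "\<And>z. z \<in> \<Omega> \<Longrightarrow> deriv \<psi> z * deriv g (\<psi> z) = 1"
     "\<And>z. z \<in> \<Omega> \<Longrightarrow> g (\<psi> z) = z"
    using holomorphic_has_inverse[OF hol assms(2) inj] by metis
  show ?thesis
  proof
    show "g holomorphic_on ball 0 1" using g(1) img by simp
    show "g ` ball 0 1 = \<Omega>"
      unfolding img[symmetric] using g(3) by (auto simp: image_image)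
    show "\<psi> (g u) = u" if u: "u \<in> ball 0 1" for u
    proof -
      obtain z where "z \<in> \<Omega>" "u = \<psi> z" using u img by blast
      then show ?thesis by (simp add: g(3))
    qed
    show "g 0 = w" using g(3)[OF assms(3)] zero by simp
    show "deriv \<psi> w * deriv g 0 = 1" using g(2)[OF assms(3)] zero by simp
  qed (use g(3) in auto)
qed

text \<open>The Riemann mapping theorem supplies a bijection onto the disc. A Moebius map then sends
  the image of \<open>w\<close> to 0, and the rotation by \<open>u\<close> makes the derivative
  positive.\<close>

lemma normalized_conformal_map_exists:
  assumes "open \<Omega>" "simply_connected \<Omega>" "w \<in> \<Omega>" "\<Omega> \<noteq> UNIV"
  shows "\<exists>\<psi>. normalized_conformal_map \<Omega> w \<psi>"
proof -
  obtain f g where f: "f holomorphic_on \<Omega>" and g: "g holomorphic_on ball 0 1"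
    and fg: "\<And>z. z \<in> \<Omega> \<Longrightarrow> f z \<in> ball 0 1 \<and> g (f z) = z"
    and gf: "\<And>z. z \<in> ball 0 1 \<Longrightarrow> g z \<in> \<Omega> \<and> f (g z) = z"
    using Riemann_mapping_theorem[of \<Omega>] assms by blast
  define a where "a = f w"
  have a: "norm a < 1" using fg[OF assms(3)] by (simp add: a_def)
  define \<phi> where "\<phi> = Moebius_function 0 a \<circ> f"
  have "Moebius_function 0 a holomorphic_on f ` \<Omega>"
    using Moebius_function_holomorphic[OF a] fg by (blast intro: holomorphic_on_subset)
  then have hol: "\<phi> holomorphic_on \<Omega>"
    unfolding \<phi>_def by (rule holomorphic_on_compose[OF f])
  have bij: "bij_betw \<phi> \<Omega> (ball 0 1)"
  proof (rule bij_betw_byWitness[where f' = "g \<circ> Moebius_function 0 (-a)"])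
    show "\<forall>z\<in>\<Omega>. (g \<circ> Moebius_function 0 (- a)) (\<phi> z) = z"
      using fg a by (auto simp: \<phi>_def Moebius_function_compose)
    show "\<forall>u\<in>ball 0 1. \<phi> ((g \<circ> Moebius_function 0 (- a)) u) = u"
      using gf a by (auto simp: \<phi>_def Moebius_function_compose Moebius_function_norm_lt_1)
    show "\<phi> ` \<Omega> \<subseteq> ball 0 1"
      using fg a by (auto simp: \<phi>_def Moebius_function_norm_lt_1)
    show "(g \<circ> Moebius_function 0 (- a)) ` ball 0 1 \<subseteq> \<Omega>"
      using gf a by (auto simp: Moebius_function_norm_lt_1)
  qed
  define D where "D = deriv \<phi> w"
  have D: "D \<noteq> 0"
    unfolding D_def using holomorphic_injective_imp_regular[OF hol assms(1)] bij assms(3)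
    by (auto simp: bij_betw_def)
  define u where "u = of_real (norm D) / D"
  have u: "norm u = 1" using D by (simp add: u_def norm_divide)
  have "bij_betw ((*) u) (ball 0 1) (ball 0 1)"
  proof (rule bij_betw_byWitness[where f' = "\<lambda>z. z / u"])
  qed (use u in \<open>auto simp: norm_mult norm_divide\<close>)
  then have bij': "bij_betw ((*) u \<circ> \<phi>) \<Omega> (ball 0 1)"
    using bij bij_betw_trans by blast
  have "\<phi> field_differentiable at w"
    using hol assms holomorphic_on_imp_differentiable_at by blast
  then have "deriv (\<lambda>z. u * \<phi> z) w = u * D"
    by (simp add: D_def)
  then have der: "deriv ((*) u \<circ> \<phi>) w = of_real (norm D)"
    using D by (simp add: u_def comp_def)
  have "((*) u \<circ> \<phi>) holomorphic_on \<Omega>"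
    unfolding comp_def by (intro holomorphic_intros hol)
  then have "normalized_conformal_map \<Omega> w ((*) u \<circ> \<phi>)"
    unfolding normalized_conformal_map_def using bij' der D
    by (simp add: \<phi>_def a_def Moebius_function_eq_zero)
  then show ?thesis by blast
qed

text \<open>Schwarz's lemma for \<open>\<psi>' \<circ> g\<close>, a self-map of the disc fixing 0,
  where \<open>g\<close> inverts \<open>\<psi>\<close>.\<close>

lemma normalized_conformal_map_mono:
  assumes "normalized_conformal_map \<Omega> w \<psi>" "normalized_conformal_map \<Omega>' w \<psi>'"
    and "open \<Omega>" "open \<Omega>'" "\<Omega> \<subseteq> \<Omega>'" "w \<in> \<Omega>"
  shows "Re (deriv \<psi>' w) \<le> Re (deriv \<psi> w)"
proof -
  obtain g where g: "g holomorphic_on ball 0 1" "g ` ball 0 1 = \<Omega>"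
    "g 0 = w" "deriv \<psi> w * deriv g 0 = 1"
    using normalized_conformal_map_inverse[OF assms(1,3,6)] by metis
  have hol': "\<psi>' holomorphic_on \<Omega>'" and bij': "bij_betw \<psi>' \<Omega>' (ball 0 1)" and "\<psi>' w = 0"
    using assms(2) by (auto simp: normalized_conformal_map_def)
  have "\<psi>' holomorphic_on g ` ball 0 1"
    using holomorphic_on_subset[OF hol' assms(5)] g(2) by simp
  then have "(\<psi>' \<circ> g) holomorphic_on ball 0 1"
    by (rule holomorphic_on_compose[OF g(1)])
  moreover have "(\<psi>' \<circ> g) 0 = 0" using g \<open>\<psi>' w = 0\<close> by simp
  moreover have "norm ((\<psi>' \<circ> g) z) < 1" if "norm z < 1" for z
  proof -
    have "g z \<in> \<Omega>" using g(2) that by auto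
    then show ?thesis using bij' assms(5) by (force simp: bij_betw_def)
  qed
  ultimately have le: "norm (deriv (\<psi>' \<circ> g) 0) \<le> 1"
    using Schwarz_Lemma(2)[of "\<psi>' \<circ> g" 0] by simp
  have "deriv (\<psi>' \<circ> g) 0 = deriv \<psi>' (g 0) * deriv g 0"
  proof (rule deriv_chain)
    show "g field_differentiable at 0"
      using g(1) by (rule holomorphic_on_imp_differentiable_at) auto
    show "\<psi>' field_differentiable at (g 0)"
      using hol' assms(4) by (rule holomorphic_on_imp_differentiable_at) (use g assms in auto)
  qed
  then have "norm (deriv \<psi>' w) * norm (deriv g 0) \<le> 1"
    using le g by (simp add: norm_mult)
  moreover have "norm (deriv g 0) = 1 / norm (deriv \<psi> w)"
    using arg_cong[OF g(4), of norm] nonzero_divide_eq_eq[of "norm (deriv \<psi> w)"]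
    by (metis mult.commute mult_zero_left norm_mult norm_one zero_neq_one)
  moreover have "norm (deriv \<psi> w) = Re (deriv \<psi> w)" "norm (deriv \<psi>' w) = Re (deriv \<psi>' w)" "Re (deriv \<psi> w) > 0"
    using assms(1,2) by (simp_all add: normalized_conformal_map_def in_Reals_norm complex_is_Real_iff)
  ultimately show ?thesis by (simp add: field_simps)
qed

text \<open>The definite description is legitimate: monotonicity, used in both directions with equal
  domains, gives any two normalized maps the same derivative at \<open>w\<close>.\<close>

lemma conformal_radius_eq:
  assumes "normalized_conformal_map \<Omega> w \<psi>" "open \<Omega>" "w \<in> \<Omega>"
  shows "conformal_radius \<Omega> w = 1 / Re (deriv \<psi> w)"
  unfolding conformal_radius_def
proof (rule the_equality)
  fix r assume "\<exists>\<psi>. normalized_conformal_map \<Omega> w \<psi> \<and> r = 1 / Re (deriv \<psi> w)"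
  then obtain \<psi>' where \<psi>': "normalized_conformal_map \<Omega> w \<psi>'" "r = 1 / Re (deriv \<psi>' w)"
    by blast
  have "Re (deriv \<psi>' w) = Re (deriv \<psi> w)"
    using normalized_conformal_map_mono[OF assms(1) \<psi>'(1) assms(2,2) order_refl assms(3)]
      normalized_conformal_map_mono[OF \<psi>'(1) assms(1) assms(2,2) order_refl assms(3)] by simp
  then show "r = 1 / Re (deriv \<psi> w)" using \<psi>' by simp
qed (use assms in blast)

lemma conformal_radius_mono:
  assumes "open \<Omega>" "simply_connected \<Omega>" "open \<Omega>'" "simply_connected \<Omega>'" "\<Omega>' \<noteq> UNIV"
    and "\<Omega> \<subseteq> \<Omega>'" "w \<in> \<Omega>"
  shows "conformal_radius \<Omega> w \<le> conformal_radius \<Omega>' w"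
proof -
  obtain \<psi> where \<psi>: "normalized_conformal_map \<Omega> w \<psi>"
    using normalized_conformal_map_exists[of \<Omega> w] assms by blast
  obtain \<psi>' where \<psi>': "normalized_conformal_map \<Omega>' w \<psi>'"
    using normalized_conformal_map_exists[of \<Omega>' w] assms by blast
  have "Re (deriv \<psi>' w) \<le> Re (deriv \<psi> w)"
    using normalized_conformal_map_mono[OF \<psi> \<psi>'] assms by blast
  moreover have "Re (deriv \<psi>' w) > 0" using \<psi>' by (simp add: normalized_conformal_map_def)
  moreover have "w \<in> \<Omega>'" using assms by blast
  ultimately show ?thesis
    using conformal_radius_eq[OF \<psi>] conformal_radius_eq[OF \<psi>'] assms
    by (auto intro!: divide_left_mono mult_pos_pos)
qed

lemma conformal_radius_scale:
  assumes "open \<Omega>" "simply_connected \<Omega>" "0 \<in> \<Omega>" "\<Omega> \<noteq> UNIV" "a > 0"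
  shows "conformal_radius ((*) (of_real a) ` \<Omega>) 0 = a * conformal_radius \<Omega> 0"
proof -
  obtain \<psi> where \<psi>: "normalized_conformal_map \<Omega> 0 \<psi>"
    using normalized_conformal_map_exists[of \<Omega> 0] assms by blast
  define h where "h = (\<lambda>z::complex. z / of_real a)"
  let ?S = "(*) (of_real a) ` \<Omega>"
  have "open ((\<lambda>z. a *\<^sub>R z) ` \<Omega>)" using assms by (intro open_scaling) auto
  then have S: "open ?S" by (simp add: scaleR_conv_of_real)
  have h: "bij_betw h ?S \<Omega>"
    by (rule bij_betw_byWitness[where f' = "(*) (of_real a)"]) (use assms in \<open>auto simp: h_def\<close>)
  have hol: "\<psi> holomorphic_on \<Omega>" and bij: "bij_betw \<psi> \<Omega> (ball 0 1)" and zero: "\<psi> 0 = 0"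
    using \<psi> by (auto simp: normalized_conformal_map_def)
  have "h holomorphic_on ?S" unfolding h_def using assms by (intro holomorphic_intros) auto
  moreover have "\<psi> holomorphic_on h ` ?S" using h hol by (simp add: bij_betw_def)
  ultimately have hol': "(\<psi> \<circ> h) holomorphic_on ?S" by (rule holomorphic_on_compose)
  have "(\<psi> has_field_derivative deriv \<psi> 0) (at (h 0))"
    using hol assms by (auto simp: h_def intro: holomorphic_derivI)
  moreover have "(h has_field_derivative 1 / of_real a) (at 0)"
    unfolding h_def using assms by (auto intro!: derivative_eq_intros)
  ultimately have "((\<psi> \<circ> h) has_field_derivative deriv \<psi> 0 * (1 / of_real a)) (at 0)"
    by (rule DERIV_chain)
  then have der: "deriv (\<psi> \<circ> h) 0 = deriv \<psi> 0 / of_real a"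
    by (simp add: DERIV_imp_deriv)
  have "normalized_conformal_map ?S 0 (\<psi> \<circ> h)"
    using \<psi> hol' bij_betw_trans[OF h bij] der zero assms
    by (simp add: normalized_conformal_map_def h_def)
  moreover have "0 \<in> ?S" using assms by force
  ultimately have "conformal_radius ?S 0 = 1 / Re (deriv (\<psi> \<circ> h) 0)"
    using S conformal_radius_eq by blast
  also have "\<dots> = a * (1 / Re (deriv \<psi> 0))"
    using assms by (simp add: der field_simps)
  also have "1 / Re (deriv \<psi> 0) = conformal_radius \<Omega> 0"
    using conformal_radius_eq[OF \<psi>] assms by simp
  finally show ?thesis .
qed

text \<open>Maximum modulus on one circle close to the unit circle. The bound is phrased as a limit
  from inside because \<open>f\<close> need not extend to the boundary.\<close>

lemma norm_at_centre_le:
  assumes "f holomorphic_on ball 0 1"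
    and "eventually (\<lambda>r. \<forall>u. norm u = r \<longrightarrow> norm (f u) \<le> B) (at_left 1)"
  shows "norm (f 0) \<le> B"
proof -
  have "eventually (\<lambda>r. r \<in> {0<..<1::real}) (at_left 1)"
    using eventually_at_left_real[of 0 1] by simp
  with assms(2) have "eventually (\<lambda>r. r \<in> {0<..<1} \<and> (\<forall>u. norm u = r \<longrightarrow> norm (f u) \<le> B)) (at_left 1)"
    by eventually_elim auto
  from eventually_happens'[OF trivial_limit_at_left_real this]
  obtain r where r: "0 < r" "r < 1" "\<And>u. norm u = r \<Longrightarrow> norm (f u) \<le> B"
    by auto
  show ?thesis
  proof (rule maximum_modulus_frontier[of f "cball 0 r"])
    show "f holomorphic_on interior (cball 0 r)"
      using assms(1) by (rule holomorphic_on_subset) (use r in auto)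
    show "continuous_on (closure (cball 0 r)) f"
      by (rule continuous_on_subset[OF holomorphic_on_imp_continuous_on[OF assms(1)]]) (use r in auto)
  qed (use r in auto)
qed

text \<open>Write the inverse Riemann map as \<open>g u = u * k u\<close>; then |k 0| is the
  conformal radius. Near the unit circle the logarithm of the modulus of
  \<open>exp (H (g u)) / k u\<close> is at most \<open>\<eta>\<close> in absolute value, up to an
  arbitrarily small error. As this function is holomorphic without zeros, the maximum principle for
  it and for its reciprocal carries both bounds to 0.\<close>

lemma conformal_radius_boundary_estimate:
  assumes "open \<Omega>" "simply_connected \<Omega>" "0 \<in> \<Omega>" "bounded \<Omega>"
    and "open U" "closure \<Omega> \<subseteq> U" "H holomorphic_on U"
    and est: "\<And>z. z \<in> frontier \<Omega> \<Longrightarrow> \<bar>ln (norm z) - Re (H z)\<bar> < \<eta>"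
  shows "conformal_radius \<Omega> 0 > 0" "\<bar>ln (conformal_radius \<Omega> 0) - Re (H 0)\<bar> \<le> \<eta>"
proof -
  have "\<Omega> \<noteq> UNIV" using assms(4) not_bounded_UNIV by blast
  then obtain \<psi> where \<psi>: "normalized_conformal_map \<Omega> 0 \<psi>"
    using normalized_conformal_map_exists assms by blast
  then obtain g where g: "g holomorphic_on ball 0 1" "g ` ball 0 1 = \<Omega>"
    "\<And>u. u \<in> ball 0 1 \<Longrightarrow> \<psi> (g u) = u" "g 0 = 0" "deriv \<psi> 0 * deriv g 0 = 1"
    using normalized_conformal_map_inverse assms by metis
  obtain k where k: "k holomorphic_on ball 0 1" "\<And>u. norm u < 1 \<Longrightarrow> g u = u * k u" "deriv g 0 = k 0"
    using Schwarz3[OF g(1,4)] by metis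
  \<comment> \<open>A zero of \<open>k\<close> is a zero of \<open>g\<close>, so by injectivity it
    lies at 0; but there \<open>k\<close> takes the value of the derivative of \<open>g\<close>,
    which is nonzero.\<close>
  have k_nz: "k u \<noteq> 0" if "u \<in> ball 0 1" for u
  proof
    assume "k u = 0"
    then have "g u = 0" using k that by simp
    then have "u = 0" using g(3)[OF that] g(3)[of 0] g(4) by simp
    then show False using g(5) k(3) \<open>k u = 0\<close> by simp
  qed
  define q where "q u = exp (H (g u)) / k u" for u
  have "g ` ball 0 1 \<subseteq> U" using g(2) assms(6) closure_subset by blast
  then have "(H \<circ> g) holomorphic_on ball 0 1"
    using holomorphic_on_compose[OF g(1)] holomorphic_on_subset[OF assms(7)] by blast
  then have H: "(\<lambda>u. H (g u)) holomorphic_on ball 0 1" by (simp add: comp_def)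
  have q: "q holomorphic_on ball 0 1" and q': "(\<lambda>u. 1 / q u) holomorphic_on ball 0 1"
    unfolding q_def using k_nz by (auto intro!: holomorphic_intros k(1) H)
  have deriv: "Re (deriv \<psi> 0) > 0" "norm (deriv \<psi> 0) = Re (deriv \<psi> 0)"
    using \<psi> by (simp_all add: normalized_conformal_map_def in_Reals_norm complex_is_Real_iff)
  have cr: "conformal_radius \<Omega> 0 = norm (k 0)"
  proof -
    have "norm (deriv \<psi> 0) * norm (k 0) = 1" using g(5) k(3) by (metis norm_mult norm_one)
    then show ?thesis
      using conformal_radius_eq[OF \<psi>] assms(1,3) deriv
      by (simp add: divide_eq_eq mult.commute)
  qed
  show "conformal_radius \<Omega> 0 > 0" using cr k_nz[of 0] by simp
  \<comment> \<open>The strict estimate on the frontier persists on an open neighbourhood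
    \<open>W\<close>. The rest \<open>K\<close> of the closure is a compact subset of
    \<open>\<Omega>\<close>, so its image under \<open>\<psi>\<close> stays away from the unit
    circle; hence \<open>g u\<close> lies in \<open>W\<close> as soon as |u| is close to 1.\<close>
  have near: "eventually (\<lambda>r. \<forall>u. norm u = r \<longrightarrow> \<bar>ln (norm (q u))\<bar> \<le> \<eta> + e) (at_left 1)" if "e > 0" for e
  proof -
    have "frontier \<Omega> \<subseteq> U" using assms(6) by (auto simp: frontier_def)
    define W where "W = (\<lambda>z. \<bar>ln (norm z) - Re (H z)\<bar>) -` {..<\<eta>} \<inter> (U - {0})"
    have "continuous_on (U - {0}) (\<lambda>z. \<bar>ln (norm z) - Re (H z)\<bar>)"
      using continuous_on_subset[OF holomorphic_on_imp_continuous_on[OF assms(7)]]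
      by (intro continuous_intros) auto
    then have "open W"
      using continuous_on_open_vimage[of "U - {0}" "\<lambda>z. \<bar>ln (norm z) - Re (H z)\<bar>"] assms(5)
      unfolding W_def by (simp add: open_delete)
    have fW: "frontier \<Omega> \<subseteq> W"
    proof
      fix z assume z: "z \<in> frontier \<Omega>"
      have "z \<noteq> 0" using z assms(1,3) by (auto simp: frontier_def interior_open)
      then show "z \<in> W" using est[OF z] z \<open>frontier \<Omega> \<subseteq> U\<close> by (auto simp: W_def)
    qed
    define K where "K = closure \<Omega> - W"
    have "compact K" unfolding K_def
      using assms(4) \<open>open W\<close> by (simp add: compact_diff)
    moreover have "K \<subseteq> \<Omega>" using fW assms(1) by (auto simp: K_def frontier_def interior_open)
    moreover have "continuous_on \<Omega> \<psi>"
      using \<psi> by (auto simp: normalized_conformal_map_def intro: holomorphic_on_imp_continuous_on)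
    \<comment> \<open>Adding 0 ensures that a point of maximal norm exists even if \<open>K\<close>
      is empty.\<close>
    ultimately have "compact (insert 0 (\<psi> ` K))" 
      by (meson compact_continuous_image compact_insert continuous_on_subset)
    then obtain u0 where u0: "u0 \<in> insert 0 (\<psi> ` K)" "\<And>u. u \<in> insert 0 (\<psi> ` K) \<Longrightarrow> norm u \<le> norm u0"
      using continuous_attains_sup[of "insert 0 (\<psi> ` K)" norm] continuous_on_norm_id by blast
    have "\<psi> ` K \<subseteq> ball 0 1"
      using \<open>K \<subseteq> \<Omega>\<close> \<psi> by (auto simp: normalized_conformal_map_def bij_betw_def)
    then have "norm u0 < 1" using u0(1) by auto
    then have "eventually (\<lambda>r. r \<in> {norm u0<..<1}) (at_left 1)"
      by (rule eventually_at_left_real)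
    moreover have "eventually (\<lambda>r. \<bar>ln r\<bar> < e) (at_left (1::real))"
    proof -
      have "((\<lambda>r. \<bar>ln r\<bar>) \<longlongrightarrow> \<bar>ln (1::real)\<bar>) (at_left 1)"
        by (intro tendsto_intros) auto
      then show ?thesis using that order_tendstoD(2) by fastforce
    qed
    ultimately show ?thesis
    proof eventually_elim
      case (elim r)
      show ?case
      proof (intro allI impI)
        fix u :: complex assume u: "norm u = r"
        have r: "0 < r" "r < 1" using elim(1) norm_ge_zero[of u0] unfolding greaterThanLessThan_iff by linarith+
        have "g u \<in> \<Omega>" using g(2) u r by auto
        moreover have "g u \<notin> K"
        proof
          assume "g u \<in> K"
          then have "u \<in> \<psi> ` K" using g(3)[of u] u r by (metis image_eqI mem_ball_0)
          then show False using u0(2)[of u] u elim by simp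
        qed
        ultimately have "g u \<in> W" using closure_subset by (auto simp: K_def)
        then have *: "\<bar>ln (norm (g u)) - Re (H (g u))\<bar> < \<eta>" by (simp add: W_def)
        \<comment> \<open>Since |g u| = r |k u|, passing from \<open>g\<close> to \<open>k\<close>
          costs only |ln r| < e.\<close>
        have "ln (norm (q u)) = Re (H (g u)) - ln (norm (k u))"
          using k_nz[of u] u r by (simp add: q_def norm_divide ln_div)
        moreover have "ln (norm (g u)) = ln r + ln (norm (k u))"
          using k_nz[of u] u r by (simp add: k(2) norm_mult ln_mult)
        ultimately show "\<bar>ln (norm (q u))\<bar> \<le> \<eta> + e"
          using * elim by linarith
      qed
    qed
  qed
  have q_nz: "q u \<noteq> 0" if "norm u < 1" for u using k_nz that by (auto simp: q_def)
  have "\<bar>ln (norm (q 0))\<bar> \<le> \<eta> + e" if "e > 0" for e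
  proof -
    have "eventually (\<lambda>r. r \<in> {0<..<1::real}) (at_left 1)"
      using eventually_at_left_real[of 0 1] by simp
    with near[OF that] have "eventually (\<lambda>r. \<forall>u. norm u = r \<longrightarrow> norm (q u) \<le> exp (\<eta> + e) \<and> norm (1 / q u) \<le> exp (\<eta> + e)) (at_left 1)"
    proof eventually_elim
      case (elim r)
      show ?case
      proof (intro allI impI)
        fix u :: complex assume u: "norm u = r"
        have "norm (q u) > 0" using q_nz[of u] u elim by simp
        then have "norm (q u) = exp (ln (norm (q u)))" "norm (1 / q u) = exp (- ln (norm (q u)))"
          by (simp_all add: norm_divide exp_minus field_simps)
        moreover have "\<bar>ln (norm (q u))\<bar> \<le> \<eta> + e" using elim u by blast
        ultimately show "norm (q u) \<le> exp (\<eta> + e) \<and> norm (1 / q u) \<le> exp (\<eta> + e)"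
          by (metis abs_le_iff exp_le_cancel_iff)
      qed
    qed
    then have "norm (q 0) \<le> exp (\<eta> + e)" "norm (1 / q 0) \<le> exp (\<eta> + e)"
      by (auto intro!: norm_at_centre_le[OF q] norm_at_centre_le[OF q'] elim: eventually_mono)
    moreover have "norm (q 0) > 0" using q_nz[of 0] by simp
    then have "norm (q 0) = exp (ln (norm (q 0)))" "norm (1 / q 0) = exp (- ln (norm (q 0)))"
      by (simp_all add: norm_divide exp_minus field_simps)
    ultimately show ?thesis by (metis abs_leI exp_le_cancel_iff)
  qed
  then have "\<bar>ln (norm (q 0))\<bar> \<le> \<eta>" by (rule field_le_epsilon)
  moreover have "ln (norm (q 0)) = Re (H 0) - ln (norm (k 0))"
    using k_nz[of 0] g(4) by (simp add: q_def norm_divide ln_div)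
  ultimately show "\<bar>ln (conformal_radius \<Omega> 0) - Re (H 0)\<bar> \<le> \<eta>"
    unfolding cr by linarith
qed

section \<open>Dented discs\<close>

text \<open>Equally spaced heights instead of equally spaced angles: the separation of the anchors
  can be read off their imaginary parts without trigonometry.\<close>

definition anchor :: "nat \<Rightarrow> nat \<Rightarrow> complex" where
  "anchor m i = Complex (sqrt (1 - (real i / real m)\<^sup>2)) (real i / real m)"

text \<open>
  With margin \<open>s\<close> and depth \<open>\<delta>\<close>, the truncation of the kernels costs
  \<open>m (12 s m\<^sup>2) = 1/20\<close> and the displacement of the boundary \<open>O(m\<^sup>2 \<delta> / s\<^sup>3)\<close>, both
  relative to \<open>\<delta>\<close>; the constants keep the total below \<open>1/10\<close>.
\<close>

definition margin :: "nat \<Rightarrow> real" where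
  "margin m = 1 / (240 * real m ^ 3)"

definition dent_depth :: "nat \<Rightarrow> real" where
  "dent_depth m = margin m ^ 3 / (600 * (real m)\<^sup>2)"

definition pole :: "nat \<Rightarrow> nat \<Rightarrow> complex" where
  "pole m i = of_real (1 + margin m) * anchor m i"

definition pole_kernel :: "nat \<Rightarrow> nat \<Rightarrow> complex \<Rightarrow> complex" where
  "pole_kernel m i z = (pole m i + z) / (pole m i - z)"

text \<open>
  The truncation level exceeds the kernel at all points of the circle at distance at least \<open>1 / (2 m)\<close>
  from the anchor, which makes the supports of different dents disjoint.
\<close>

definition dent :: "nat \<Rightarrow> nat \<Rightarrow> complex \<Rightarrow> real" where
  "dent m i z = max 0 (Re (pole_kernel m i z) - 12 * margin m * (real m)\<^sup>2)"

definition radial :: "nat \<Rightarrow> nat set \<Rightarrow> complex \<Rightarrow> real" where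
  "radial m X z = 1 - dent_depth m * (\<Sum>i\<in>X. dent m i z)"

text \<open>As \<open>sgn 0 = 0\<close>, the origin belongs to the set because \<open>radial m X 0\<close> is positive.\<close>

definition dented_disc :: "nat \<Rightarrow> nat set \<Rightarrow> complex set" where
  "dented_disc m X = {z. norm z < radial m X (sgn z)}"

lemma norm_sgn_le: "norm (sgn z :: complex) \<le> 1"
  by (simp add: norm_sgn)

lemma sgn_scale: "r > 0 \<Longrightarrow> sgn (of_real r * z :: complex) = sgn z"
  by (simp add: sgn_mult sgn_of_real)

context
  fixes m :: nat
  assumes m: "m \<ge> 1"
begin

section \<open>Anchors, poles and kernels\<close>

lemma margin_bounds: "0 < margin m" "margin m \<le> 1 / 240" "margin m * real m ^ 3 = 1 / 240"
proof -
  have "real m ^ 3 \<ge> 1" using m by simp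
  then show "margin m \<le> 1 / 240" unfolding margin_def using m by (intro divide_left_mono) auto
  show "0 < margin m" "margin m * real m ^ 3 = 1 / 240" using m by (auto simp: margin_def)
qed

lemma dent_depth_pos: "dent_depth m > 0"
  using margin_bounds m by (simp add: dent_depth_def)

lemma norm_anchor: "i < m \<Longrightarrow> norm (anchor m i) = 1"
proof -
  assume "i < m"
  then have "(real i / real m)\<^sup>2 \<le> 1" by (intro power_le_one) auto
  then show ?thesis by (simp add: anchor_def cmod_def)
qed

lemma norm_pole: "i < m \<Longrightarrow> norm (pole m i) = 1 + margin m"
  using norm_anchor margin_bounds by (simp add: pole_def norm_mult del: of_real_add)

lemma anchor_separated:
  assumes "i \<noteq> j"
  shows "dist (anchor m i) (anchor m j) \<ge> 1 / real m"
proof -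
  have "1 \<le> \<bar>real i - real j\<bar>" using assms by linarith
  then have "1 / real m \<le> \<bar>real i / real m - real j / real m\<bar>"
    using m by (simp add: diff_divide_distrib[symmetric] divide_right_mono)
  also have "\<dots> \<le> dist (anchor m i) (anchor m j)"
    using abs_Im_le_cmod[of "anchor m i - anchor m j"] by (simp add: anchor_def dist_norm)
  finally show ?thesis .
qed

lemma norm_pole_diff:
  assumes "i < m" "norm z \<le> 1"
  shows "norm (pole m i - z) \<ge> margin m" "pole m i \<noteq> z"
proof -
  show *: "norm (pole m i - z) \<ge> margin m"
    using norm_triangle_ineq2[of "pole m i" z] norm_pole assms by simp
  then show "pole m i \<noteq> z" using margin_bounds by auto
qed

lemma pole_kernel_0: "i < m \<Longrightarrow> pole_kernel m i 0 = 1"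
  using norm_pole_diff[of i 0] by (simp add: pole_kernel_def)

lemma pole_kernel_holomorphic: "pole_kernel m i holomorphic_on - {pole m i}"
  unfolding pole_kernel_def by (intro holomorphic_intros) auto

text \<open>The Poisson kernel of the disc through the pole, up to a constant factor. This form
  shows positivity inside that disc and smallness on the unit circle away from the pole.\<close>

lemma Re_pole_kernel: "Re (pole_kernel m i z) = ((norm (pole m i))\<^sup>2 - (norm z)\<^sup>2) / (norm (pole m i - z))\<^sup>2"
  unfolding pole_kernel_def Re_divide cmod_power2
  by (rule arg_cong2[where f = "(/)"]) (simp_all add: power2_eq_square algebra_simps)

lemma Re_pole_kernel_nonneg:
  assumes "i < m" "norm z \<le> 1"
  shows "Re (pole_kernel m i z) \<ge> 0"
proof -
  have "(norm z)\<^sup>2 \<le> (norm (pole m i))\<^sup>2"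
    using assms norm_pole margin_bounds by (intro power_mono) auto
  then show ?thesis unfolding Re_pole_kernel by simp
qed

lemma norm_pole_kernel_le:
  assumes "i < m" "norm z \<le> 1"
  shows "norm (pole_kernel m i z) \<le> 3 / margin m"
proof -
  have "norm (pole m i + z) \<le> 3"
    using norm_triangle_ineq[of "pole m i" z] norm_pole assms margin_bounds by simp
  then show ?thesis
    unfolding pole_kernel_def norm_divide using norm_pole_diff[OF assms] margin_bounds
    by (intro frac_le) auto
qed

text \<open>Over a common denominator the difference is \<open>2 * a * (z - z')\<close> divided by
  two factors of modulus at least \<open>margin m\<close>.\<close>

lemma pole_kernel_lipschitz:
  assumes "i < m" "norm z \<le> 1" "norm z' \<le> 1"
  shows "norm (pole_kernel m i z - pole_kernel m i z') \<le> 4 / (margin m)\<^sup>2 * norm (z - z')"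
proof -
  let ?a = "pole m i"
  have ne: "?a - z \<noteq> 0" "?a - z' \<noteq> 0" using norm_pole_diff assms by auto
  then have "pole_kernel m i z - pole_kernel m i z' = (2 * ?a * (z - z')) / ((?a - z) * (?a - z'))"
    unfolding pole_kernel_def by (simp add: divide_simps) (simp add: algebra_simps)
  then have "norm (pole_kernel m i z - pole_kernel m i z') = 2 * (1 + margin m) * norm (z - z') / (norm (?a - z) * norm (?a - z'))"
    using assms norm_pole by (simp add: norm_divide norm_mult)
  also have "\<dots> \<le> 4 * norm (z - z') / (margin m * margin m)"
    using norm_pole_diff assms margin_bounds
    by (intro frac_le mult_mono mult_pos_pos) (auto intro: mult_right_mono)
  finally show ?thesis by (simp add: power2_eq_square)
qed

text \<open>On the unit circle the pole is at least as far from \<open>z\<close> as its anchor is.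
  With s the margin, the numerator (1 + s)^2 - 1 is at most 3 s, and 3 s (2 m)^2 is the truncation
  level.\<close>

lemma Re_pole_kernel_far:
  assumes "i < m" "norm z = 1" "dist z (anchor m i) \<ge> 1 / (2 * real m)"
  shows "Re (pole_kernel m i z) \<le> 12 * margin m * (real m)\<^sup>2"
proof -
  let ?s = "margin m" and ?e = "anchor m i"
  \<comment> \<open>The real inner product of anchor and \<open>z\<close>, needed to expand the
    square of the norm of (e - z) + s e.\<close>
  define c where "c = Re ?e * Re z + Im ?e * Im z"
  have "(norm (pole m i - z))\<^sup>2 = ?s\<^sup>2 * (norm ?e)\<^sup>2 + 2 * ?s * ((norm ?e)\<^sup>2 - c) + (norm (?e - z))\<^sup>2"
    unfolding pole_def cmod_power2 c_def by (simp add: power2_eq_square algebra_simps)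
  moreover have "(norm (?e - z))\<^sup>2 = (norm ?e)\<^sup>2 + (norm z)\<^sup>2 - 2 * c"
    unfolding cmod_power2 c_def by (simp add: power2_eq_square algebra_simps)
  then have "(norm ?e)\<^sup>2 - c = (norm (?e - z))\<^sup>2 / 2"
    using assms norm_anchor by simp
  ultimately have "(norm (pole m i - z))\<^sup>2 = ?s\<^sup>2 + ?s * (norm (?e - z))\<^sup>2 + (norm (?e - z))\<^sup>2"
    using assms norm_anchor by simp
  then have "(norm (pole m i - z))\<^sup>2 \<ge> (norm (?e - z))\<^sup>2" using margin_bounds by simp
  also have "(norm (?e - z))\<^sup>2 \<ge> (1 / (2 * real m))\<^sup>2"
    using assms m by (intro power_mono) (auto simp: dist_norm norm_minus_commute)
  finally have far: "(norm (pole m i - z))\<^sup>2 \<ge> (1 / (2 * real m))\<^sup>2" by simp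
  have "(1 + ?s)\<^sup>2 - 1 \<le> 3 * ?s"
    using margin_bounds by (simp add: power2_eq_square algebra_simps)
  then have "Re (pole_kernel m i z) \<le> 3 * ?s / (1 / (2 * real m))\<^sup>2"
    unfolding Re_pole_kernel using assms norm_pole margin_bounds m far
    by (intro frac_le) auto
  then show ?thesis by (simp add: power2_eq_square field_simps)
qed

section \<open>Truncated kernels\<close>

lemma dent_nonneg: "dent m i z \<ge> 0" by (simp add: dent_def)

text \<open>Two anchors are at least 1/m apart, so \<open>z\<close> is at distance at least 1/(2 m)
  from one of them, where the truncation yields 0.\<close>

lemma dent_disjoint:
  assumes "i < m" "j < m" "i \<noteq> j" "norm z = 1"
  shows "dent m i z = 0 \<or> dent m j z = 0"
proof -
  have "1 / real m \<le> dist z (anchor m i) + dist z (anchor m j)"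
    using anchor_separated[OF assms(3)] dist_triangle3[of "anchor m i" "anchor m j" z] by linarith
  then have "dist z (anchor m i) \<ge> 1 / (2 * real m) \<or> dist z (anchor m j) \<ge> 1 / (2 * real m)"
    by (auto simp: field_simps)
  then show ?thesis using Re_pole_kernel_far[of _ z] assms by (fastforce simp: dent_def)
qed

text \<open>As the kernel is nonnegative on the closed disc, truncation changes it by at most the
  level subtracted.\<close>

lemma dent_approx:
  assumes "i < m" "norm z \<le> 1"
  shows "\<bar>dent m i z - Re (pole_kernel m i z)\<bar> \<le> 12 * margin m * (real m)\<^sup>2"
  using Re_pole_kernel_nonneg[OF assms] margin_bounds by (auto simp: dent_def max_def abs_if)

lemma dent_le:
  assumes "i < m" "norm z \<le> 1"
  shows "dent m i z \<le> 3 / margin m"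
proof -
  have "Re (pole_kernel m i z) \<le> 3 / margin m"
    using norm_pole_kernel_le[OF assms] complex_Re_le_cmod order_trans by blast
  moreover have "12 * margin m * (real m)\<^sup>2 \<ge> 0" "3 / margin m \<ge> 0" using margin_bounds by auto
  ultimately show ?thesis unfolding dent_def by linarith
qed

lemma dent_lipschitz:
  assumes "i < m" "norm z \<le> 1" "norm z' \<le> 1"
  shows "\<bar>dent m i z - dent m i z'\<bar> \<le> 4 / (margin m)\<^sup>2 * norm (z - z')"
proof -
  have "\<bar>dent m i z - dent m i z'\<bar> \<le> \<bar>Re (pole_kernel m i z - pole_kernel m i z')\<bar>"
    by (auto simp: dent_def max_def abs_if)
  also have "\<dots> \<le> norm (pole_kernel m i z - pole_kernel m i z')" by (rule abs_Re_le_cmod)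
  finally show ?thesis using pole_kernel_lipschitz[OF assms] by linarith
qed

section \<open>The radial function of a set of dents\<close>

context
  fixes X :: "nat set"
  assumes X: "X \<subseteq> {..<m}"
begin

lemma card_X: "card X \<le> m"
  using card_mono[OF _ X] by auto

lemma sum_X_le:
  assumes "\<And>i. i < m \<Longrightarrow> f i \<le> b" "0 \<le> b"
  shows "(\<Sum>i\<in>X. f i) \<le> real m * b"
proof -
  have "(\<Sum>i\<in>X. f i) \<le> real (card X) * b"
    using X assms by (intro sum_bounded_above) auto
  also have "\<dots> \<le> real m * b" using card_X assms by (intro mult_right_mono) auto
  finally show ?thesis .
qed

lemma dent_depth_sum_le:
  assumes "norm z \<le> 1"
  shows "dent_depth m * (\<Sum>i\<in>X. dent m i z) \<le> (margin m)\<^sup>2 / (200 * real m)"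
proof -
  have "(\<Sum>i\<in>X. dent m i z) \<le> real m * (3 / margin m)"
    using dent_le assms margin_bounds by (intro sum_X_le) auto
  then have "dent_depth m * (\<Sum>i\<in>X. dent m i z) \<le> dent_depth m * (real m * (3 / margin m))"
    using dent_depth_pos by (intro mult_left_mono) auto
  also have "\<dots> = (margin m)\<^sup>2 / (200 * real m)"
    using m margin_bounds by (simp add: dent_depth_def field_simps power2_eq_square power3_eq_cube)
  finally show ?thesis .
qed

lemma radial_bounds:
  assumes "norm z \<le> 1"
  shows "1 / 2 \<le> radial m X z" "radial m X z \<le> 1"
proof -
  have "(margin m)\<^sup>2 / (200 * real m) \<le> 1 / 2"
  proof -
    have "(margin m)\<^sup>2 \<le> 1" using margin_bounds by (intro power_le_one) auto
    also have "1 \<le> 100 * real m" using m by simp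
    finally show ?thesis using m by (simp add: field_simps)
  qed
  then show "1 / 2 \<le> radial m X z"
    using dent_depth_sum_le[OF assms] by (simp add: radial_def)
  show "radial m X z \<le> 1"
    using dent_depth_pos by (simp add: radial_def sum_nonneg dent_nonneg)
qed

text \<open>At most \<open>m\<close> dents with Lipschitz constant 4/s^2 each, scaled by the depth,
  give the constant s/(150 m) with s the margin; 1 is a convenient upper bound.\<close>

lemma radial_lipschitz:
  assumes "norm z \<le> 1" "norm z' \<le> 1"
  shows "\<bar>radial m X z - radial m X z'\<bar> \<le> norm (z - z')"
proof -
  have "\<bar>(\<Sum>i\<in>X. dent m i z) - (\<Sum>i\<in>X. dent m i z')\<bar> \<le> (\<Sum>i\<in>X. \<bar>dent m i z - dent m i z'\<bar>)"
    unfolding sum_subtractf[symmetric] by (rule sum_abs)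
  also have "\<dots> \<le> real m * (4 / (margin m)\<^sup>2 * norm (z - z'))"
    using dent_lipschitz assms by (intro sum_X_le) auto
  finally have le: "\<bar>(\<Sum>i\<in>X. dent m i z) - (\<Sum>i\<in>X. dent m i z')\<bar> \<le> real m * (4 / (margin m)\<^sup>2 * norm (z - z'))" .
  have "\<bar>radial m X z - radial m X z'\<bar> = dent_depth m * \<bar>(\<Sum>i\<in>X. dent m i z) - (\<Sum>i\<in>X. dent m i z')\<bar>"
  proof -
    have "radial m X z - radial m X z' = dent_depth m * ((\<Sum>i\<in>X. dent m i z') - (\<Sum>i\<in>X. dent m i z))"
      by (simp add: radial_def right_diff_distrib)
    then show ?thesis using dent_depth_pos by (simp add: abs_mult abs_minus_commute)
  qed
  also have "\<dots> \<le> dent_depth m * (real m * (4 / (margin m)\<^sup>2 * norm (z - z')))"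
    using le dent_depth_pos by (intro mult_left_mono) auto
  also have "\<dots> = margin m / (150 * real m) * norm (z - z')"
    using m margin_bounds by (simp add: dent_depth_def field_simps power2_eq_square power3_eq_cube)
  also have "\<dots> \<le> 1 * norm (z - z')"
  proof (intro mult_right_mono)
    have "margin m \<le> 150 * real m" using margin_bounds m by linarith
    then show "margin m / (150 * real m) \<le> 1" using m by simp
  qed auto
  finally show ?thesis by simp
qed

section \<open>Topology of the dented disc\<close>

lemma continuous_on_radial_sgn: "continuous_on (- {0}) (\<lambda>z. radial m X (sgn z))"
proof -
  have "1-lipschitz_on (cball 0 1) (radial m X)"
    using radial_lipschitz by (auto intro!: lipschitz_onI simp: dist_norm)
  then have "continuous_on (cball 0 1) (radial m X)" by (rule lipschitz_on_continuous_on)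
  moreover have "continuous_on (- {0::complex}) sgn"
    unfolding sgn_div_norm[abs_def] by (intro continuous_intros) auto
  ultimately show ?thesis
    by (rule continuous_on_compose2) (auto intro: norm_sgn_le)
qed

lemma open_vimage_radial:
  assumes "open B"
  shows "open ((\<lambda>z. norm z - radial m X (sgn z)) -` B \<inter> - {0})"
proof -
  have "continuous_on (- {0}) (\<lambda>z. norm z - radial m X (sgn z))"
    by (intro continuous_on_diff continuous_on_norm_id continuous_on_radial_sgn)
  moreover have "open (- {0::complex})" by (intro open_Compl) simp
  ultimately show ?thesis using continuous_on_open_vimage assms by blast
qed

lemma open_dented_disc: "open (dented_disc m X)"
proof -
  \<comment> \<open>\<open>sgn\<close> is discontinuous at 0, so a neighbourhood of the origin is
    treated separately; the ball fits because the radial function is at least 1/2.\<close>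
  have "dented_disc m X = ball 0 (1/2) \<union> ((\<lambda>z. norm z - radial m X (sgn z)) -` {..<0} \<inter> - {0})"
  proof (intro set_eqI)
    fix z
    show "z \<in> dented_disc m X \<longleftrightarrow> z \<in> ball 0 (1/2) \<union> ((\<lambda>z. norm z - radial m X (sgn z)) -` {..<0} \<inter> - {0})"
      using radial_bounds(1)[OF norm_sgn_le, of z] by (auto simp: dented_disc_def)
  qed
  moreover have "open ((\<lambda>z. norm z - radial m X (sgn z)) -` {..<0} \<inter> - {0})"
    using open_vimage_radial by simp
  ultimately show ?thesis by auto
qed

lemma zero_in_dented_disc: "0 \<in> dented_disc m X"
  using radial_bounds[of 0] by (simp add: dented_disc_def)

lemma dented_disc_subset: "dented_disc m X \<subseteq> ball 0 1"
proof
  fix z assume "z \<in> dented_disc m X"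
  then show "z \<in> ball 0 1"
    using radial_bounds(2)[OF norm_sgn_le, of z] by (simp add: dented_disc_def)
qed

lemma scale_in_dented_disc:
  assumes "z \<in> dented_disc m X" "0 \<le> t" "t \<le> 1"
  shows "of_real t * z \<in> dented_disc m X"
proof (cases "t = 0")
  case False
  then have "norm (of_real t * z) \<le> norm z"
    using assms by (simp add: norm_mult mult_left_le_one_le)
  then show ?thesis using assms False by (simp add: dented_disc_def sgn_scale)
qed (use zero_in_dented_disc in auto)

lemma simply_connected_dented_disc: "simply_connected (dented_disc m X)"
proof (rule starlike_imp_simply_connected)
  show "starlike (dented_disc m X)"
    unfolding starlike_def
  proof (intro bexI ballI subsetI)
    fix x z assume "x \<in> dented_disc m X" "z \<in> closed_segment 0 x"
    then obtain t where "0 \<le> t" "t \<le> 1" "z = of_real t * x"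
      by (auto simp: closed_segment_def scaleR_conv_of_real)
    then show "z \<in> dented_disc m X"
      using scale_in_dented_disc \<open>x \<in> dented_disc m X\<close> by simp
  qed (rule zero_in_dented_disc)
qed

text \<open>The points beyond the radial curve form an open set \<open>E\<close> disjoint from the
  disc, so no frontier point lies there. Conversely, a point of the curve is the limit of its own
  contractions towards 0, which belong to the disc.\<close>

lemma frontier_dented_disc:
  "frontier (dented_disc m X) = (\<lambda>e. of_real (radial m X e) * e) ` sphere 0 1"
proof (intro set_eqI iffI)
  fix z assume z: "z \<in> frontier (dented_disc m X)"
  have nz: "z \<noteq> 0" and notin: "z \<notin> dented_disc m X"
    using z zero_in_dented_disc open_dented_disc by (auto simp: frontier_def interior_open)
  define E where "E = (\<lambda>z. norm z - radial m X (sgn z)) -` {0<..} \<inter> - {0}"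
  have "open E"
    unfolding E_def using open_vimage_radial by simp
  moreover have "E \<inter> dented_disc m X = {}" by (auto simp: E_def dented_disc_def)
  ultimately have "z \<notin> E"
    using z by (metis Diff_iff IntI empty_iff frontier_def open_Int_closure_eq_empty)
  then have "norm z = radial m X (sgn z)"
    using notin nz by (simp add: E_def dented_disc_def)
  then have "z = of_real (radial m X (sgn z)) * sgn z"
    using nz by (simp add: sgn_eq)
  then show "z \<in> (\<lambda>e. of_real (radial m X e) * e) ` sphere 0 1"
    using nz by (intro image_eqI) (auto simp: norm_sgn)
next
  fix z assume "z \<in> (\<lambda>e. of_real (radial m X e) * e) ` sphere 0 1"
  then obtain e where e: "norm e = 1" "z = of_real (radial m X e) * e" by auto
  have R: "radial m X e > 0" using radial_bounds[of e] e by simp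
  have sg: "sgn z = e" using e R by (simp add: sgn_scale) (simp add: sgn_eq)
  have nz: "norm z = radial m X e" using e R by (simp add: norm_mult)
  have "z \<notin> dented_disc m X" using sg nz by (simp add: dented_disc_def)
  moreover have "z \<in> closure (dented_disc m X)"
  proof (rule closure_sequential[THEN iffD2], intro exI conjI allI)
    fix n :: nat
    \<comment> \<open>The offset 2 keeps the factor positive for \<open>n = 0\<close>, so that the
      direction of \<open>z\<close> is preserved.\<close>
    show "of_real (1 - 1 / real (Suc (Suc n))) * z \<in> dented_disc m X"
    proof -
      have t: "0 < 1 - 1 / real (Suc (Suc n))" "1 - 1 / real (Suc (Suc n)) < 1" by (auto simp: field_simps)
      have "norm (of_real (1 - 1 / real (Suc (Suc n))) * z) = (1 - 1 / real (Suc (Suc n))) * radial m X e"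
        using t by (simp only: norm_mult nz norm_of_real)
      also have "\<dots> < radial m X e" using t R by simp
      finally show ?thesis using t sg by (simp add: dented_disc_def sgn_scale del: of_real_diff of_nat_Suc)
    qed
    have "(\<lambda>n. 1 - 1 / real (Suc (Suc n))) \<longlonglongrightarrow> 1 - 0"
      using LIMSEQ_Suc[OF LIMSEQ_inverse_real_of_nat] by (intro tendsto_diff tendsto_const) (simp add: inverse_eq_divide)
    then have "(\<lambda>n. of_real (1 - 1 / real (Suc (Suc n))) * z) \<longlonglongrightarrow> of_real (1 - 0) * z"
      by (intro tendsto_mult tendsto_of_real tendsto_const)
    then show "(\<lambda>n. of_real (1 - 1 / real (Suc (Suc n))) * z) \<longlonglongrightarrow> z" by simp
  qed
  ultimately show "z \<in> frontier (dented_disc m X)"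
    using open_dented_disc by (simp add: frontier_def interior_open)
qed

text \<open>Error budget in units of the depth: 1/100 for replacing ln (1 - y) by -y, 1/20 for the
  truncation, and 1/50 for evaluating the kernels at \<open>z\<close> instead of \<open>e\<close>,
  which is at distance \<open>y\<close>. The total 8/100 is below 1/10.\<close>

lemma dented_disc_boundary_estimate:
  assumes "norm e = 1"
  defines "z \<equiv> of_real (radial m X e) * e"
  shows "\<bar>ln (norm z) + dent_depth m * (\<Sum>i\<in>X. Re (pole_kernel m i z))\<bar> < dent_depth m / 10"
proof -
  let ?s = "margin m" and ?\<delta> = "dent_depth m" and ?M = "real m"
  define y where "y = ?\<delta> * (\<Sum>i\<in>X. dent m i e)"
  have M: "?M \<ge> 1" using m by simp
  have R: "radial m X e = 1 - y" by (simp add: radial_def y_def)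
  have y: "0 \<le> y" "y \<le> 1 / 2" using radial_bounds[of e] assms R by auto
  have y_le: "y \<le> ?s\<^sup>2 / (200 * ?M)" using dent_depth_sum_le[of e] assms by (simp add: y_def)
  have "norm z = \<bar>1 - y\<bar>" unfolding z_def R norm_mult norm_of_real using assms by simp
  then have nz: "norm z = 1 - y" using y by simp
  have "\<bar>ln (norm z) + y\<bar> \<le> 2 * y\<^sup>2"
    using abs_ln_one_plus_x_minus_x_bound[of "-y"] y nz by simp
  also have "2 * y\<^sup>2 \<le> 2 * (?s\<^sup>2 / (200 * ?M))\<^sup>2"
    using y y_le by (intro mult_left_mono power_mono) auto
  also have "\<dots> = ?\<delta> * (3 * ?s / 100)"
    using M margin_bounds by (simp add: dent_depth_def field_simps power2_eq_square power3_eq_cube)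
  also have "\<dots> \<le> ?\<delta> * (1 / 100)"
    using dent_depth_pos margin_bounds by (intro mult_left_mono) auto
  finally have 1: "\<bar>ln (norm z) + y\<bar> \<le> ?\<delta> * (1 / 100)" .
  have ez: "norm (e - z) = y"
  proof -
    have "e - z = of_real y * e" by (simp add: z_def R algebra_simps)
    then show ?thesis using assms y by (simp add: norm_mult)
  qed
  have "\<bar>dent m i e - Re (pole_kernel m i z)\<bar> \<le> 12 * ?s * ?M\<^sup>2 + 4 / ?s\<^sup>2 * (?s\<^sup>2 / (200 * ?M))" if "i < m" for i
  proof -
    have "\<bar>dent m i e - Re (pole_kernel m i e)\<bar> \<le> 12 * ?s * ?M\<^sup>2"
      using dent_approx that assms by simp
    moreover have "\<bar>Re (pole_kernel m i e) - Re (pole_kernel m i z)\<bar> \<le> norm (pole_kernel m i e - pole_kernel m i z)"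
      using abs_Re_le_cmod[of "pole_kernel m i e - pole_kernel m i z"] by simp
    moreover have "\<dots> \<le> 4 / ?s\<^sup>2 * y"
      using pole_kernel_lipschitz[OF that, of e z] ez nz y assms by simp
    moreover have "4 / ?s\<^sup>2 * y \<le> 4 / ?s\<^sup>2 * (?s\<^sup>2 / (200 * ?M))"
      using y_le by (intro mult_left_mono) auto
    ultimately show ?thesis by linarith
  qed
  moreover have "0 \<le> 12 * ?s * ?M\<^sup>2 + 4 / ?s\<^sup>2 * (?s\<^sup>2 / (200 * ?M))"
    using margin_bounds by simp
  ultimately have "(\<Sum>i\<in>X. \<bar>dent m i e - Re (pole_kernel m i z)\<bar>) \<le> ?M * (12 * ?s * ?M\<^sup>2 + 4 / ?s\<^sup>2 * (?s\<^sup>2 / (200 * ?M)))"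
    by (intro sum_X_le)
  also have "\<dots> = 12 * (?s * ?M ^ 3) + 1 / 50"
    using M margin_bounds(1) by (simp add: field_simps power2_eq_square power3_eq_cube)
  also have "\<dots> = 7 / 100" by (simp add: margin_bounds(3))
  finally have 2: "(\<Sum>i\<in>X. \<bar>dent m i e - Re (pole_kernel m i z)\<bar>) \<le> 7 / 100" .
  have "\<bar>(\<Sum>i\<in>X. dent m i e) - (\<Sum>i\<in>X. Re (pole_kernel m i z))\<bar> \<le> 7 / 100"
    unfolding sum_subtractf[symmetric] using sum_abs 2 by (rule order_trans)
  then have "?\<delta> * \<bar>(\<Sum>i\<in>X. dent m i e) - (\<Sum>i\<in>X. Re (pole_kernel m i z))\<bar> \<le> ?\<delta> * (7 / 100)"
    using dent_depth_pos by (intro mult_left_mono) auto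
  then have "\<bar>?\<delta> * ((\<Sum>i\<in>X. dent m i e) - (\<Sum>i\<in>X. Re (pole_kernel m i z)))\<bar> \<le> ?\<delta> * (7 / 100)"
    using dent_depth_pos by (simp add: abs_mult)
  then have "\<bar>y - ?\<delta> * (\<Sum>i\<in>X. Re (pole_kernel m i z))\<bar> \<le> ?\<delta> * (7 / 100)"
    by (simp add: y_def right_diff_distrib)
  then show ?thesis using 1 dent_depth_pos by linarith
qed

text \<open>The boundary estimate with \<open>H\<close> equal to minus the depth times the sum of
  the kernels. It is holomorphic beyond the closed unit disc, since the poles lie on the circle of
  radius \<open>1 + margin m\<close>, and every kernel equals 1 at the origin.\<close>

lemma conformal_radius_dented_disc:
  "conformal_radius (dented_disc m X) 0 > 0"
  "\<bar>ln (conformal_radius (dented_disc m X) 0) + dent_depth m * real (card X)\<bar> \<le> dent_depth m / 10"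
proof -
  define H where "H z = - of_real (dent_depth m) * (\<Sum>i\<in>X. pole_kernel m i z)" for z
  define U where "U = ball (0::complex) (1 + margin m)"
  have "U \<subseteq> - {pole m i}" if "i < m" for i
    using norm_pole[OF that] by (auto simp: U_def)
  then have "pole_kernel m i holomorphic_on U" if "i \<in> X" for i
    using X that pole_kernel_holomorphic holomorphic_on_subset by blast
  then have H: "H holomorphic_on U" unfolding H_def by (intro holomorphic_intros)
  have "closure (dented_disc m X) \<subseteq> cball 0 1"
    using dented_disc_subset by (metis closure_ball closure_mono zero_less_one zero_neq_one)
  also have "\<dots> \<subseteq> U" using margin_bounds by (auto simp: U_def)
  finally have U: "closure (dented_disc m X) \<subseteq> U" .
  have "bounded (dented_disc m X)" using dented_disc_subset bounded_ball bounded_subset by blast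
  moreover have "\<bar>ln (norm z) - Re (H z)\<bar> < dent_depth m / 10" if z: "z \<in> frontier (dented_disc m X)" for z
  proof -
    obtain e where "norm e = 1" "z = of_real (radial m X e) * e"
      using z frontier_dented_disc by auto
    then show ?thesis
      using dented_disc_boundary_estimate[of e] by (simp add: H_def)
  qed
  moreover have "Re (H 0) = - (dent_depth m * real (card X))"
    using X by (simp add: H_def pole_kernel_0 subset_iff)
  ultimately show "conformal_radius (dented_disc m X) 0 > 0"
    "\<bar>ln (conformal_radius (dented_disc m X) 0) + dent_depth m * real (card X)\<bar> \<le> dent_depth m / 10"
    using conformal_radius_boundary_estimate[OF open_dented_disc simply_connected_dented_disc
      zero_in_dented_disc _ _ U H, of "dent_depth m / 10"] by (auto simp: U_def)
qed

end

end

section \<open>Pixels of dented discs\<close>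

text \<open>If an open simply connected set is unbounded, all components of its frontier are
  unbounded. A bounded frontier then has no component, is empty, and the set is the whole
  plane.\<close>

lemma simply_connected_bounded_frontier_imp_bounded:
  fixes S :: "complex set"
  assumes "open S" "simply_connected S" "S \<noteq> UNIV" "bounded (frontier S)"
  shows "bounded S"
proof (rule ccontr)
  assume nb: "\<not> bounded S"
  have "\<not> bounded C" if "C \<in> components (frontier S)" for C
    using simply_connected_eq_frontier_properties[OF assms(1)] assms(2) nb that by auto
  moreover have "bounded C" if "C \<in> components (frontier S)" for C
    using that assms(4) bounded_subset in_components_subset by blast
  ultimately have "frontier S = {}" by (metis components_eq_empty ex_in_conv)
  then show False using assms(3) nb frontier_eq_empty[of S] by auto
qed

text \<open>Scaled by |y|, the difference of directions is x - y plus (|y| - |x|) times the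
  direction of x, and both terms have norm at most |x - y|.\<close>

lemma dist_sgn_le:
  fixes x y :: "'a :: real_normed_vector"
  assumes "y \<noteq> 0"
  shows "dist (sgn x) (sgn y) \<le> 2 * dist x y / norm y"
proof (cases "x = 0")
  case False
  have "norm y *\<^sub>R (sgn x - sgn y) = (x - y) + (norm y - norm x) *\<^sub>R sgn x"
    using assms False by (simp add: sgn_div_norm algebra_simps)
  then have "norm y * norm (sgn x - sgn y) = norm ((x - y) + (norm y - norm x) *\<^sub>R sgn x)"
    by (metis abs_norm_cancel norm_scaleR)
  also have "\<dots> \<le> norm (x - y) + norm ((norm y - norm x) *\<^sub>R sgn x)" by (rule norm_triangle_ineq)
  also have "norm ((norm y - norm x) *\<^sub>R sgn x) = \<bar>norm y - norm x\<bar>" using False by (simp add: norm_sgn)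
  also have "\<dots> \<le> norm (x - y)" by (metis norm_minus_commute norm_triangle_ineq3)
  finally show ?thesis using assms by (simp add: dist_norm field_simps)
qed (use assms in \<open>simp add: norm_sgn\<close>)

text \<open>\<open>\<Omega>\<close> is squeezed between two dilations of the dented disc;
  monotonicity and scaling of the conformal radius then give a relative error.\<close>

lemma conformal_radius_near_dented_disc:
  assumes m: "m \<ge> 1" and X: "X \<subseteq> {..<m}" and h: "0 < h" "h \<le> 1 / 40"
    and Om: "open \<Omega>" "simply_connected \<Omega>" "0 \<in> \<Omega>" "\<Omega> \<noteq> UNIV"
    and near: "\<And>z. z \<in> frontier \<Omega> \<Longrightarrow> \<exists>y\<in>frontier (dented_disc m X). dist z y < 2 * h"
  shows "\<bar>conformal_radius \<Omega> 0 - conformal_radius (dented_disc m X) 0\<bar> \<le> 21 * h * conformal_radius (dented_disc m X) 0"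
proof -
  let ?D = "dented_disc m X" and ?R = "radial m X"
  \<comment> \<open>A frontier point differs from the radial curve in its direction by at most 2 h
    in norm plus 8 h from the change of direction. As the radial function is at least 1/2, a
    relative error of 20 h covers this; 21 leaves room for strict inequalities.\<close>
  define \<kappa> where "\<kappa> = 21 * h"
  have \<kappa>: "0 < \<kappa>" "\<kappa> < 1" using h by (auto simp: \<kappa>_def)
  have Rb: "1 / 2 \<le> ?R (sgn z)" "?R (sgn z) \<le> 1" for z
    using radial_bounds[OF m X norm_sgn_le] by auto
  have scaled: "(*) (of_real a) ` ?D = {z. norm z < a * ?R (sgn z)}" if "a > 0" for a
  proof (intro set_eqI iffI)
    fix z assume "z \<in> (*) (of_real a) ` ?D"
    then show "z \<in> {z. norm z < a * ?R (sgn z)}"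
      using that by (auto simp: dented_disc_def sgn_scale norm_mult)
  next
    fix z assume "z \<in> {z. norm z < a * ?R (sgn z)}"
    then have "of_real (1 / a) * z \<in> ?D"
      using that sgn_scale[of "1 / a" z]
      by (simp add: dented_disc_def norm_mult norm_divide field_simps)
    then show "z \<in> (*) (of_real a) ` ?D"
      using that by (intro image_eqI[of _ _ "of_real (1 / a) * z"]) auto
  qed
  have bdry: "(1 - \<kappa>) * ?R (sgn z) < norm z \<and> norm z < (1 + \<kappa>) * ?R (sgn z)" if z: "z \<in> frontier \<Omega>" for z
  proof -
    obtain y where "y \<in> frontier ?D" "dist z y < 2 * h" using near[OF z] by blast
    then obtain e where e: "norm e = 1" "y = of_real (?R e) * e"
      using frontier_dented_disc[OF m X] by auto
    have Re: "1 / 2 \<le> ?R e" using radial_bounds[OF m X] e by simp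
    have ny: "norm y = ?R e" using e Re by (simp add: norm_mult)
    have sy: "sgn y = e" using e Re by (simp add: sgn_scale) (simp add: sgn_eq)
    have "\<bar>?R (sgn z) - ?R e\<bar> \<le> dist (sgn z) (sgn y)"
      using radial_lipschitz[OF m X, of "sgn z" e] norm_sgn_le e sy by (simp add: dist_norm)
    also have "\<dots> \<le> 2 * dist z y / norm y"
      using ny Re by (intro dist_sgn_le) auto
    also have "\<dots> \<le> 2 * (2 * h) / (1 / 2)"
      using \<open>dist z y < 2 * h\<close> ny Re h by (intro frac_le) auto
    finally have "\<bar>?R (sgn z) - ?R e\<bar> \<le> 8 * h" by simp
    moreover have "\<bar>norm z - norm y\<bar> < 2 * h"
      using norm_triangle_ineq3[of z y] \<open>dist z y < 2 * h\<close> by (simp add: dist_norm)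
    ultimately have "\<bar>norm z - ?R (sgn z)\<bar> < 10 * h" using ny by linarith
    moreover have "10 * h \<le> \<kappa> * ?R (sgn z)"
      using mult_left_mono[OF Rb(1)[of z], of \<kappa>] \<kappa> h by (simp add: \<kappa>_def)
    ultimately show ?thesis by (auto simp: algebra_simps)
  qed
  have "bounded (frontier \<Omega>)"
  proof (rule boundedI)
    fix z assume "z \<in> frontier \<Omega>"
    then have "norm z \<le> (1 + \<kappa>) * ?R (sgn z)" using bdry by fastforce
    also have "\<dots> \<le> 2 * 1" using Rb \<kappa> by (intro mult_mono) (auto intro: order_trans[OF _ Rb(1)])
    finally show "norm z \<le> 2" by simp
  qed
  then have bd: "bounded \<Omega>"
    using simply_connected_bounded_frontier_imp_bounded Om by blast
  have upper: "\<Omega> \<subseteq> (*) (of_real (1 + \<kappa>)) ` ?D"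
  proof (rule ccontr)
    assume "\<not> ?thesis"
    then obtain z where z: "z \<in> \<Omega>" "norm z \<ge> (1 + \<kappa>) * ?R (sgn z)"
      using scaled[of "1 + \<kappa>"] \<kappa> by force
    have "(1 + \<kappa>) * ?R (sgn z) > 0"
      using Rb(1)[of z] \<kappa> by (intro mult_pos_pos) linarith+
    then have "z \<noteq> 0" using z(2) by auto
    \<comment> \<open>The ray from \<open>z\<close> away from 0 stays outside the larger dilation
      but must leave the bounded set \<open>\<Omega>\<close>, so it meets the frontier where
      \<open>bdry\<close> excludes it.\<close>
    define ray where "ray = (\<lambda>t. of_real t * z) ` {1..}"
    have "connected ray"
      unfolding ray_def by (intro connected_continuous_image continuous_intros) auto
    moreover have "ray \<inter> \<Omega> \<noteq> {}"
    proof -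
      have "of_real 1 * z \<in> ray" unfolding ray_def by (rule imageI) simp
      then show ?thesis using z by auto
    qed
    moreover have "ray - \<Omega> \<noteq> {}"
    proof -
      obtain B where B: "\<And>x. x \<in> \<Omega> \<Longrightarrow> norm x \<le> B" using bd bounded_iff by metis
      define t where "t = 1 + (\<bar>B\<bar> + 1) / norm z"
      have "t \<ge> 1" by (simp add: t_def)
      have "norm (of_real t * z) = t * norm z" using \<open>t \<ge> 1\<close> by (simp add: norm_mult)
      also have "\<dots> = norm z + \<bar>B\<bar> + 1" using \<open>z \<noteq> 0\<close> by (simp add: t_def field_simps)
      finally have "of_real t * z \<notin> \<Omega>" using B[of "of_real t * z"] norm_ge_zero[of z] by linarith
      then show ?thesis using \<open>t \<ge> 1\<close> by (auto simp: ray_def)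
    qed
    ultimately have "ray \<inter> frontier \<Omega> \<noteq> {}" by (rule connected_Int_frontier)
    then obtain t where t: "t \<ge> 1" "of_real t * z \<in> frontier \<Omega>" by (auto simp: ray_def)
    have "norm (of_real t * z) = t * norm z" using t by (simp add: norm_mult)
    also have "\<dots> \<ge> norm z" using t by (simp add: mult_le_cancel_right1)
    finally have "norm (of_real t * z) \<ge> (1 + \<kappa>) * ?R (sgn z)" using z(2) by linarith
    then show False using bdry[OF t(2)] sgn_scale[of t z] t by simp
  qed
  \<comment> \<open>The smaller dilation is connected and shares 0 with \<open>\<Omega>\<close>, so
    it can only leave \<open>\<Omega>\<close> through the frontier, which \<open>bdry\<close> keeps
    outside it.\<close>
  have lower: "(*) (of_real (1 - \<kappa>)) ` ?D \<subseteq> \<Omega>"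
  proof (rule ccontr)
    let ?S = "(*) (of_real (1 - \<kappa>)) ` ?D"
    assume "\<not> ?thesis"
    moreover have "connected ?S"
      using simply_connected_imp_connected[OF simply_connected_dented_disc[OF m X]]
      by (intro connected_continuous_image continuous_intros)
    moreover have "0 \<in> ?S" using zero_in_dented_disc[OF m X] by force
    ultimately have "?S \<inter> frontier \<Omega> \<noteq> {}" using Om(3) by (intro connected_Int_frontier) auto
    then obtain z where z: "z \<in> ?S" "z \<in> frontier \<Omega>" by blast
    have "norm z < (1 - \<kappa>) * ?R (sgn z)" using z(1) scaled[of "1 - \<kappa>"] \<kappa> by simp
    then show False using bdry[OF z(2)] by simp
  qed
  note D = open_dented_disc[OF m X] simply_connected_dented_disc[OF m X] zero_in_dented_disc[OF m X]
  have bdD: "bounded ?D" using dented_disc_subset[OF m X] bounded_ball bounded_subset by blast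
  have DU: "?D \<noteq> UNIV" using bdD not_bounded_UNIV by metis
  have sc: "open ((*) (of_real a) ` ?D)" "simply_connected ((*) (of_real a) ` ?D)"
    "(*) (of_real a) ` ?D \<noteq> UNIV" "0 \<in> (*) (of_real a) ` ?D"
    "conformal_radius ((*) (of_real a) ` ?D) 0 = a * conformal_radius ?D 0" if "a > 0" for a
  proof -
    have eq: "(*) (of_real a) ` ?D = (\<lambda>z. a *\<^sub>R z) ` ?D" by (simp add: scaleR_conv_of_real)
    show "open ((*) (of_real a) ` ?D)" unfolding eq using that D by (intro open_scaling) auto
    show "0 \<in> (*) (of_real a) ` ?D" using D(3) by force
    show "(*) (of_real a) ` ?D \<noteq> UNIV"
      using bounded_scaling[OF bdD, of a] not_bounded_UNIV unfolding eq by metis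
    show "conformal_radius ((*) (of_real a) ` ?D) 0 = a * conformal_radius ?D 0"
      using conformal_radius_scale D DU that by blast
    have "?D homeomorphic (*) (of_real a) ` ?D"
      unfolding eq using that by (intro homeomorphic_scaling) auto
    then show "simply_connected ((*) (of_real a) ` ?D)"
      using D(2) homeomorphic_simply_connected_eq by blast
  qed
  have "conformal_radius \<Omega> 0 \<le> (1 + \<kappa>) * conformal_radius ?D 0"
    using conformal_radius_mono[OF Om(1,2) sc(1,2,3) upper Om(3)] sc(5) \<kappa>
    by (simp del: of_real_add)
  moreover have "(1 - \<kappa>) * conformal_radius ?D 0 \<le> conformal_radius \<Omega> 0"
    using conformal_radius_mono[OF sc(1,2) Om(1,2,4) lower sc(4)] sc(5) \<kappa>
    by (simp del: of_real_diff)
  ultimately show ?thesis by (auto simp: \<kappa>_def abs_le_iff algebra_simps)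
qed

lemma dent_depth_small:
  assumes m: "m \<ge> 1"
  shows "dent_depth m * real m \<le> 1 / 600"
proof -
  have "margin m ^ 3 \<le> 1" using margin_bounds[OF m] by (intro power_le_one) auto
  also have "1 \<le> real m" using m by simp
  finally show ?thesis using m by (simp add: dent_depth_def field_simps power2_eq_square)
qed

text \<open>Crude bounds from |ln r| <= 1/2 and exp x >= 1 + x. They convert logarithmic into
  additive estimates and limit the number of answer bits that matter.\<close>

lemma conformal_radius_dented_disc_bounds:
  assumes m: "m \<ge> 1" and X: "X \<subseteq> {..<m}"
  shows "1 / 2 \<le> conformal_radius (dented_disc m X) 0" "conformal_radius (dented_disc m X) 0 \<le> 2"
proof -
  define r where "r = conformal_radius (dented_disc m X) 0"
  have r: "r > 0" using conformal_radius_dented_disc(1)[OF m X] by (simp add: r_def)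
  have "dent_depth m * real (card X) \<le> dent_depth m * real m"
    using card_X[OF m X] dent_depth_pos[OF m] by (intro mult_left_mono) auto
  moreover have "dent_depth m * 1 \<le> dent_depth m * real m"
    using m dent_depth_pos[OF m] by (intro mult_left_mono) auto
  moreover have "0 \<le> dent_depth m * real (card X)" using dent_depth_pos[OF m] by simp
  ultimately have "\<bar>ln r\<bar> \<le> 1 / 2"
    using conformal_radius_dented_disc(2)[OF m X] dent_depth_small[OF m] unfolding r_def by linarith
  then have "exp (ln r) \<ge> 1 / 2" "exp (- ln r) \<ge> 1 / 2"
    using exp_ge_add_one_self[of "ln r"] exp_ge_add_one_self[of "- ln r"] by linarith+
  then show "1 / 2 \<le> r" "r \<le> 2" using r by (simp_all add: exp_minus field_simps)
qed

text \<open>The smallest admissible choice of pixels: wherever the value is free, it is 0.\<close>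

definition dent_pixel :: "nat \<Rightarrow> nat set \<Rightarrow> nat \<Rightarrow> int \<Rightarrow> int \<Rightarrow> bool" where
  "dent_pixel m X k i j \<longleftrightarrow> ball (grid_point k i j) (1 / 2 ^ k) \<inter> frontier (dented_disc m X) \<noteq> {}"

text \<open>
  A boundary point lies on at most one dent, hence its position depends on a single input bit
  \<open>b\<close>, that of dent \<open>l\<close>.
\<close>

definition dent_literal :: "nat \<Rightarrow> nat \<Rightarrow> int \<Rightarrow> int \<Rightarrow> nat \<Rightarrow> bool \<Rightarrow> bool" where
  "dent_literal m k i j l b \<longleftrightarrow>
     (\<exists>e. norm e = 1 \<and> (\<forall>l'<m. l' \<noteq> l \<longrightarrow> dent m l' e = 0) \<and>
        of_real (1 - dent_depth m * (of_bool b * dent m l e)) * e \<in> ball (grid_point k i j) (1 / 2 ^ k))"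

text \<open>In a direction where all dents other than \<open>l\<close> vanish, the radial function
  depends on \<open>X\<close> only through membership of \<open>l\<close>. Every direction has such
  an \<open>l\<close>, as supports are disjoint, so a pixel is a disjunction over \<open>l\<close>
  of conditions on single bits.\<close>

lemma dent_pixel_iff_literal:
  assumes m: "m \<ge> 1" and X: "X \<subseteq> {..<m}"
  shows "dent_pixel m X k i j \<longleftrightarrow> (\<exists>l<m. dent_literal m k i j l (l \<in> X))"
proof -
  have rad: "radial m X e = 1 - dent_depth m * (of_bool (l \<in> X) * dent m l e)"
    if "\<forall>l'<m. l' \<noteq> l \<longrightarrow> dent m l' e = 0" for l e
  proof -
    have "(\<Sum>i\<in>X. dent m i e) = (\<Sum>i\<in>X. if i = l then dent m l e else 0)"
      using X that by (intro sum.cong) auto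
    also have "\<dots> = of_bool (l \<in> X) * dent m l e"
      using finite_subset[OF X] by simp
    finally show ?thesis by (simp add: radial_def)
  qed
  have ex: "\<exists>l<m. \<forall>l'<m. l' \<noteq> l \<longrightarrow> dent m l' e = 0" if "norm e = 1" for e
  proof (cases "\<exists>l<m. dent m l e \<noteq> 0")
    case True
    then obtain l where "l < m" "dent m l e \<noteq> 0" by blast
    then show ?thesis using dent_disjoint[OF m _ _ _ that] by metis
  next
    case False
    \<comment> \<open>In a direction without any dent every index serves; 0 is the default.\<close>
    then show ?thesis using m by (intro exI[of _ 0]) auto
  qed
  show ?thesis
  proof
    assume "dent_pixel m X k i j"
    then obtain e where e: "norm e = 1" "of_real (radial m X e) * e \<in> ball (grid_point k i j) (1 / 2 ^ k)"
      by (auto simp: dent_pixel_def frontier_dented_disc[OF m X])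
    obtain l where "l < m" "\<forall>l'<m. l' \<noteq> l \<longrightarrow> dent m l' e = 0" using ex e by blast
    then show "\<exists>l<m. dent_literal m k i j l (l \<in> X)"
      using e rad[of l e] unfolding dent_literal_def by metis
  next
    assume "\<exists>l<m. dent_literal m k i j l (l \<in> X)"
    then obtain l e where "norm e = 1" "\<forall>l'<m. l' \<noteq> l \<longrightarrow> dent m l' e = 0"
      "of_real (1 - dent_depth m * (of_bool (l \<in> X) * dent m l e)) * e \<in> ball (grid_point k i j) (1 / 2 ^ k)"
      unfolding dent_literal_def by blast
    then have "norm e = 1" "of_real (radial m X e) * e \<in> ball (grid_point k i j) (1 / 2 ^ k)"
      using rad[of l e] by simp_all
    then show "dent_pixel m X k i j"
      by (auto simp: dent_pixel_def frontier_dented_disc[OF m X])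
  qed
qed

section \<open>Recovering the boundary from its pixels\<close>

lemma given_by_pixels_self:
  "given_by_pixels M k S (\<lambda>i j. ball (grid_point k i j) (1 / 2 ^ k) \<inter> S \<noteq> {})"
proof -
  have "ball (grid_point k i j) (1 / 2 ^ k) \<subseteq> ball (grid_point k i j) (2 * (1 / 2 ^ k))" for i j
    by (rule subset_ball) (simp add: divide_right_mono)
  then show ?thesis unfolding given_by_pixels_def by blast
qed

lemma given_by_pixels_cong:
  assumes "\<And>i j. \<bar>i\<bar> \<le> int (M * 2 ^ k) \<Longrightarrow> \<bar>j\<bar> \<le> int (M * 2 ^ k) \<Longrightarrow> f i j = f' i j"
  shows "given_by_pixels M k S f \<longleftrightarrow> given_by_pixels M k S f'"
  unfolding given_by_pixels_def using assms by (intro ball_cong refl) (auto simp: abs_le_iff)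

text \<open>Round both coordinates. The bound \<open>M * 2 ^ k\<close> is an integer and rounding is
  monotone, so the grid point stays in range; its distance is at most a grid step divided by the
  square root of 2.\<close>

lemma grid_point_near:
  assumes "\<bar>Re z\<bar> \<le> real M" "\<bar>Im z\<bar> \<le> real M"
  shows "\<exists>i j. \<bar>i\<bar> \<le> int (M * 2 ^ k) \<and> \<bar>j\<bar> \<le> int (M * 2 ^ k) \<and> dist (grid_point k i j) z < 1 / 2 ^ k"
proof -
  have r: "\<bar>round (x * 2 ^ k)\<bar> \<le> int (M * 2 ^ k) \<and> \<bar>of_int (round (x * 2 ^ k)) / 2 ^ k - x\<bar> \<le> 1 / 2 * (1 / 2 ^ k)"
    if "\<bar>x\<bar> \<le> real M" for x :: real
  proof
    have "\<bar>x\<bar> * 2 ^ k \<le> real M * 2 ^ k" using that by (intro mult_right_mono) auto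
    then have "\<bar>x * 2 ^ k\<bar> \<le> of_int (int (M * 2 ^ k))" by (simp add: abs_mult)
    then have "of_int (- int (M * 2 ^ k)) \<le> x * 2 ^ k" "x * 2 ^ k \<le> of_int (int (M * 2 ^ k))"
      by (simp_all add: abs_le_iff)
    from round_mono[OF this(1)] round_mono[OF this(2)] show "\<bar>round (x * 2 ^ k)\<bar> \<le> int (M * 2 ^ k)" unfolding round_of_int by linarith
    have "\<bar>of_int (round (x * 2 ^ k)) / 2 ^ k - x\<bar> = \<bar>of_int (round (x * 2 ^ k)) - x * 2 ^ k\<bar> * (1 / 2 ^ k)"
    proof -
      have "of_int (round (x * 2 ^ k)) / 2 ^ k - x = (of_int (round (x * 2 ^ k)) - x * 2 ^ k) * (1 / 2 ^ k)"
        by (simp add: diff_divide_distrib)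
      then show ?thesis by (simp only: abs_mult) simp
    qed
    also have "\<dots> \<le> 1 / 2 * (1 / 2 ^ k)"
      by (intro mult_right_mono of_int_round_abs_le) auto
    finally show "\<bar>of_int (round (x * 2 ^ k)) / 2 ^ k - x\<bar> \<le> 1 / 2 * (1 / 2 ^ k)" .
  qed
  let ?g = "grid_point k (round (Re z * 2 ^ k)) (round (Im z * 2 ^ k))"
  have "(norm (?g - z))\<^sup>2 = \<bar>Re ?g - Re z\<bar>\<^sup>2 + \<bar>Im ?g - Im z\<bar>\<^sup>2" by (simp add: cmod_power2)
  also have "\<dots> \<le> (1 / 2 * (1 / 2 ^ k))\<^sup>2 + (1 / 2 * (1 / 2 ^ k))\<^sup>2"
    using r[OF assms(1)] r[OF assms(2)] by (intro add_mono power_mono) (auto simp: grid_point_def)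
  also have "\<dots> < (1 / 2 ^ k)\<^sup>2" by (simp add: power_mult_distrib power_divide field_simps)
  finally have "norm (?g - z) < 1 / 2 ^ k" by (rule power_less_imp_less_base) simp
  then show ?thesis using r[OF assms(1)] r[OF assms(2)] unfolding dist_norm by blast
qed

text \<open>The pixel at a grid point within one step of \<open>z\<close> must be 1, and by the
  choice of \<open>dent_pixel\<close> the dented boundary is then within one step of that grid point
  as well.\<close>

lemma frontier_near_of_pixels:
  assumes "given_by_pixels M k (frontier \<Omega>) (dent_pixel m X k)" "admissible_domain M \<Omega>" "z \<in> frontier \<Omega>"
  shows "\<exists>y\<in>frontier (dented_disc m X). dist z y < 2 * (1 / 2 ^ k)"
proof -
  have "\<bar>Re z\<bar> \<le> real M" "\<bar>Im z\<bar> \<le> real M"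
    using assms(2,3) by (auto simp: admissible_domain_def)
  then obtain i j where ij: "\<bar>i\<bar> \<le> int (M * 2 ^ k)" "\<bar>j\<bar> \<le> int (M * 2 ^ k)" "dist (grid_point k i j) z < 1 / 2 ^ k"
    using grid_point_near by blast
  then have "ball (grid_point k i j) (1 / 2 ^ k) \<inter> frontier \<Omega> \<noteq> {}" using assms(3) by auto
  then have "dent_pixel m X k i j"
    using assms(1) ij by (auto simp: given_by_pixels_def abs_le_iff)
  then obtain y where "y \<in> frontier (dented_disc m X)" "dist (grid_point k i j) y < 1 / 2 ^ k"
    by (auto simp: dent_pixel_def)
  then show ?thesis using ij(3) dist_triangle3[of z y "grid_point k i j"] by (intro bexI[of _ y]) auto
qed

lemma admissible_dented_disc:
  assumes m: "m \<ge> 1" and X: "X \<subseteq> {..<m}" and "M \<ge> 1"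
  shows "admissible_domain M (dented_disc m X)"
proof -
  have sub: "dented_disc m X \<subseteq> ball 0 1" by (rule dented_disc_subset[OF m X])
  then have "dented_disc m X \<noteq> UNIV" using bounded_subset[OF bounded_ball] not_bounded_UNIV by metis
  moreover have "\<bar>Re z\<bar> \<le> real M \<and> \<bar>Im z\<bar> \<le> real M" if "z \<in> frontier (dented_disc m X)" for z
  proof -
    have "z \<in> closure (ball 0 1)" using that closure_mono[OF sub] by (auto simp: frontier_def)
    then have "norm z \<le> 1" by simp
    then show ?thesis using abs_Re_le_cmod[of z] abs_Im_le_cmod[of z] assms(3) by linarith
  qed
  ultimately show ?thesis
    using open_dented_disc[OF m X] simply_connected_dented_disc[OF m X] zero_in_dented_disc[OF m X]
    by (auto simp: admissible_domain_def)
qed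

text \<open>Quotient and remainder by the row length invert the row-major index used in
  \<open>pixel\<close>.\<close>

definition dent_string :: "nat \<Rightarrow> nat \<Rightarrow> nat \<Rightarrow> nat set \<Rightarrow> bool list" where
  "dent_string M k m X = map (\<lambda>p. dent_pixel m X k
     (int (p div (2 * M * 2 ^ k + 1)) - int (M * 2 ^ k))
     (int (p mod (2 * M * 2 ^ k + 1)) - int (M * 2 ^ k))) [0..<(2 * M * 2 ^ k + 1)\<^sup>2]"

lemma pixel_dent_string:
  assumes "\<bar>i\<bar> \<le> int (M * 2 ^ k)" "\<bar>j\<bar> \<le> int (M * 2 ^ k)"
  shows "pixel M k (dent_string M k m X) i j = dent_pixel m X k i j"
proof -
  define W where "W = 2 * M * 2 ^ k + 1"
  define a b where "a = nat (i + int (M * 2 ^ k))" and "b = nat (j + int (M * 2 ^ k))"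
  have ij: "i = int a - int (M * 2 ^ k)" "j = int b - int (M * 2 ^ k)"
    using assms by (auto simp: a_def b_def)
  have W': "int W = 2 * int (M * 2 ^ k) + 1" by (simp add: W_def)
  have lt: "a < W" "b < W" using assms W' by (simp_all add: a_def b_def nat_less_iff)
  have "a * W + b < a * W + W" using lt by simp
  also have "\<dots> = Suc a * W" by simp
  also have "\<dots> \<le> W * W" using lt by (intro mult_right_mono) auto
  finally have "a * W + b < W\<^sup>2" by (simp add: power2_eq_square)
  moreover have "(a * W + b) div W = a" "(a * W + b) mod W = b" using lt by auto
  moreover have "nat ((i + int (M * 2 ^ k)) * int W + (j + int (M * 2 ^ k))) = a * W + b"
    unfolding ij by (simp add: nat_add_distrib nat_mult_distrib flip: of_nat_mult of_nat_add)
  ultimately show ?thesis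
    unfolding pixel_def dent_string_def W_def[symmetric] by (simp add: ij)
qed

lemma given_by_pixels_dent_string:
  "given_by_pixels M k S (pixel M k (dent_string M k m X)) \<longleftrightarrow> given_by_pixels M k S (dent_pixel m X k)"
  by (rule given_by_pixels_cong) (rule pixel_dent_string)

lemma horner_sum_of_bool_surj: "\<exists>ys. horner_sum of_bool 2 ys = (a :: nat)"
proof -
  \<comment> \<open>\<open>a\<close> bits suffice because a < 2^a.\<close>
  have "horner_sum of_bool 2 (map (bit a) [0..<a]) = take_bit a a" by (rule horner_sum_bit_eq_take_bit)
  also have "\<dots> = a" by (simp add: take_bit_nat_eq_self)
  finally show ?thesis by blast
qed

text \<open>With N = 2^k, all compatible domains have conformal radius within 42/N of
  \<open>r\<close>, so rounding \<open>N * r\<close> down is an admissible answer. Conversely, the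
  dented disc is itself compatible, so every admissible answer approximates its radius.\<close>

lemma CONF_dent_string:
  assumes m: "m \<ge> 1" and X: "X \<subseteq> {..<m}" and M: "M \<ge> 1" and c: "0 < c" "c < 1 / 2" and k: "2 ^ k \<ge> (4096 :: nat)"
  shows "\<exists>ys. CONF M c (dent_string M k m X) ys"
    and "CONF M c (dent_string M k m X) ys \<Longrightarrow>
       \<bar>real (horner_sum of_bool 2 ys) / 2 ^ k - conformal_radius (dented_disc m X) 0\<bar> \<le> 1 / (2 ^ k) powr c"
proof -
  define N :: real where "N = 2 ^ k"
  define r where "r = conformal_radius (dented_disc m X) 0"
  let ?S = "dent_string M k m X"
  have len: "length ?S = (2 * M * 2 ^ k + 1)\<^sup>2" by (simp add: dent_string_def)
  have N: "N \<ge> 4096"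
    unfolding N_def using k by (metis of_nat_le_iff of_nat_numeral of_nat_power)
  have self: "admissible_domain M (dented_disc m X) \<and> given_by_pixels M k (frontier (dented_disc m X)) (pixel M k ?S)"
    using admissible_dented_disc[OF m X M] given_by_pixels_self
    unfolding given_by_pixels_dent_string dent_pixel_def[abs_def] by blast
  have r: "0 < r" "r \<le> 2"
    using conformal_radius_dented_disc_bounds[OF m X] by (simp_all add: r_def)
  \<comment> \<open>Here c < 1/2 enters: N^c is at most the square root of N, hence at most N/64
    once N is at least 4096 = 64^2.\<close>
  have "N powr c \<le> N powr (1 / 2)" using N c by (intro powr_mono) auto
  also have "\<dots> = sqrt N" using N by (simp add: powr_half_sqrt)
  finally have "64 * N powr c \<le> sqrt N * sqrt N"
    using N real_le_rsqrt[of 64 N] by (intro mult_mono) auto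
  then have "64 * N powr c \<le> N" using N by simp
  then have small: "64 / N \<le> 1 / N powr c" using N by (simp add: field_simps)
  have near: "\<bar>conformal_radius \<Omega> 0 - r\<bar> \<le> 42 / N"
    if "admissible_domain M \<Omega>" "given_by_pixels M k (frontier \<Omega>) (pixel M k ?S)" for \<Omega>
  proof -
    have "\<bar>conformal_radius \<Omega> 0 - r\<bar> \<le> 21 * (1 / N) * r"
      unfolding r_def
    proof (rule conformal_radius_near_dented_disc[OF m X])
      show "\<exists>y\<in>frontier (dented_disc m X). dist z y < 2 * (1 / N)" if "z \<in> frontier \<Omega>" for z
        using frontier_near_of_pixels that \<open>admissible_domain M \<Omega>\<close> \<open>given_by_pixels M k _ _\<close>
        unfolding given_by_pixels_dent_string N_def by blast
    qed (use that N in \<open>auto simp: admissible_domain_def field_simps\<close>)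
    also have "\<dots> \<le> 21 * (1 / N) * 2" using r N by (intro mult_left_mono) auto
    finally show ?thesis by simp
  qed
  define a where "a = nat \<lfloor>N * r\<rfloor>"
  have "0 \<le> N * r" using N r by simp
  then have "real a \<le> N * r" "N * r \<le> real a + 1" unfolding a_def by linarith+
  then have "real a / N \<le> r" "r \<le> (real a + 1) / N"
    using N by (simp_all add: pos_divide_le_eq pos_le_divide_eq mult.commute)
  then have a: "\<bar>real a / N - r\<bar> \<le> 1 / N"
    by (simp add: abs_le_iff add_divide_distrib)
  obtain ys where ys: "horner_sum of_bool 2 ys = a" using horner_sum_of_bool_surj by blast
  have "CONF M c ?S ys"
    unfolding CONF_def
  proof (intro exI[of _ k] conjI allI impI len)
    fix \<Omega> assume "admissible_domain M \<Omega> \<and> given_by_pixels M k (frontier \<Omega>) (pixel M k ?S)"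
    then have "\<bar>conformal_radius \<Omega> 0 - r\<bar> \<le> 42 / N" using near by blast
    then have "\<bar>real a / N - conformal_radius \<Omega> 0\<bar> \<le> 64 / N"
      using a N divide_right_mono[of 43 64 N] by linarith
    then show "\<bar>real (horner_sum of_bool 2 ys) / 2 ^ k - conformal_radius \<Omega> 0\<bar> \<le> 1 / (2 ^ k) powr c"
      using small unfolding ys N_def by linarith
  qed (use self in blast)
  then show "\<exists>ys. CONF M c ?S ys" ..
  show "\<bar>real (horner_sum of_bool 2 ys) / 2 ^ k - conformal_radius (dented_disc m X) 0\<bar> \<le> 1 / (2 ^ k) powr c"
    if CONF: "CONF M c ?S ys" for ys
  proof -
    \<comment> \<open>\<open>CONF\<close> hides its own resolution behind an existential; the length
      of the string determines it because \<open>M\<close> is positive.\<close>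
    obtain k' where k': "length ?S = (2 * M * 2 ^ k' + 1)\<^sup>2"
      "\<And>\<Omega>. admissible_domain M \<Omega> \<and> given_by_pixels M k' (frontier \<Omega>) (pixel M k' ?S) \<Longrightarrow>
          \<bar>real (horner_sum of_bool 2 ys) / 2 ^ k' - conformal_radius \<Omega> 0\<bar> \<le> 1 / (2 ^ k') powr c"
      using CONF unfolding CONF_def by blast
    have "(2 * M * 2 ^ k + 1)\<^sup>2 = (2 * M * 2 ^ k' + 1)\<^sup>2" using len k'(1) by metis
    then have "2 * M * 2 ^ k + 1 = 2 * M * 2 ^ k' + 1" by (simp only: power2_eq_iff_nonneg zero_le)
    then have "2 * M * 2 ^ k = 2 * M * 2 ^ k'" by linarith
    then have "(2::nat) ^ k = 2 ^ k'" using M by simp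
    then have "k' = k" by simp
    then show ?thesis using k'(2) self by blast
  qed
qed

section \<open>Layered circuits\<close>

definition wires :: "(bool list \<Rightarrow> bool list) \<Rightarrow> bool list \<Rightarrow> gate list \<Rightarrow> bool list" where
  "wires g = foldl (\<lambda>v G. v @ [gate_value g v G])"

definition wire_depths :: "nat list \<Rightarrow> gate list \<Rightarrow> nat list" where
  "wire_depths = foldl (\<lambda>d G. d @ [Suc (Max (insert 0 ((\<lambda>w. d ! w) ` set (fan_in G))))])"

definition fans_below :: "nat \<Rightarrow> gate list \<Rightarrow> bool" where
  "fans_below n gs \<longleftrightarrow> (\<forall>G\<in>set gs. \<forall>w\<in>set (fan_in G). w < n)"

lemma gate_value_append:
  assumes "\<forall>w\<in>set (fan_in G). w < length v"
  shows "gate_value g (v @ v') G = gate_value g v G"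
proof (cases G)
  case (Oracle_Gate ws j)
  then have "map (\<lambda>w. (v @ v') ! w) ws = map (\<lambda>w. v ! w) ws"
    using assms by (intro map_cong) (auto simp: nth_append)
  then show ?thesis unfolding Oracle_Gate gate_value.simps by (rule arg_cong)
qed (use assms in \<open>auto simp: nth_append\<close>)

text \<open>Gates reading only older wires cannot see each other, so sequential evaluation agrees
  with parallel evaluation.\<close>

lemma wires_layer:
  "fans_below (length v) gs \<Longrightarrow> wires g v gs = v @ map (gate_value g v) gs"
proof (induction gs rule: rev_induct)
  case (snoc G gs)
  then have "wires g v gs = v @ map (gate_value g v) gs" by (simp add: fans_below_def)
  then show ?case using snoc.prems gate_value_append[of G v] by (simp add: wires_def fans_below_def)
qed (simp add: wires_def)

lemma wires_append: "wires g v (gs @ gs') = wires g (wires g v gs) gs'"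
  by (simp add: wires_def)

lemma wire_depths_append: "wire_depths d (gs @ gs') = wire_depths (wire_depths d gs) gs'"
  by (simp add: wire_depths_def)

lemma length_wire_depths: "length (wire_depths d gs) = length d + length gs"
  by (induction gs rule: rev_induct) (simp_all add: wire_depths_def)

lemma wire_depths_layer:
  assumes "fans_below (length d) gs" "\<forall>t\<in>set d. t \<le> b"
  shows "\<forall>t\<in>set (wire_depths d gs). t \<le> Suc b"
proof -
  have "wire_depths d gs = d @ map (\<lambda>G. Suc (Max (insert 0 ((\<lambda>w. d ! w) ` set (fan_in G))))) gs"
    using assms(1)
  proof (induction gs rule: rev_induct)
    case (snoc G gs)
    then have IH: "wire_depths d gs = d @ map (\<lambda>G. Suc (Max (insert 0 ((\<lambda>w. d ! w) ` set (fan_in G))))) gs"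
      by (simp add: fans_below_def)
    have "(\<lambda>w. (d @ d') ! w) ` set (fan_in G) = (\<lambda>w. d ! w) ` set (fan_in G)" for d'
      using snoc.prems by (intro image_cong) (auto simp: nth_append fans_below_def)
    then show ?case using IH by (simp add: wire_depths_def)
  qed (simp add: wire_depths_def)
  moreover have "Max (insert 0 ((\<lambda>w. d ! w) ` set (fan_in G))) \<le> b" if "G \<in> set gs" for G
    using assms that by (auto simp: fans_below_def)
  ultimately show ?thesis using assms(2) by (auto intro: le_SucI)
qed

fun layered :: "nat \<Rightarrow> gate list list \<Rightarrow> bool" where
  "layered n [] \<longleftrightarrow> True"
| "layered n (L # Ls) \<longleftrightarrow> fans_below n L \<and> layered (n + length L) Ls"

lemma layered_wf:
  "layered n Ls \<Longrightarrow> i < length (concat Ls) \<Longrightarrow> w \<in> set (fan_in (concat Ls ! i)) \<Longrightarrow> w < n + i"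
proof (induction Ls arbitrary: n i)
  case (Cons L Ls)
  show ?case
  proof (cases "i < length L")
    case True
    then have "w < n" using Cons.prems by (auto simp: nth_append fans_below_def)
    then show ?thesis by simp
  next
    case False
    then have "w < (n + length L) + (i - length L)"
      using Cons.prems by (intro Cons.IH) (auto simp: nth_append)
    then show ?thesis using False by simp
  qed
qed simp

lemma layered_wire_depths:
  "layered (length d) Ls \<Longrightarrow> \<forall>t\<in>set d. t \<le> b \<Longrightarrow> \<forall>t\<in>set (wire_depths d (concat Ls)). t \<le> b + length Ls"
proof (induction Ls arbitrary: d b)
  case (Cons L Ls)
  have "\<forall>t\<in>set (wire_depths d L). t \<le> Suc b" using Cons.prems by (intro wire_depths_layer) auto
  then have "\<forall>t\<in>set (wire_depths (wire_depths d L) (concat Ls)). t \<le> Suc b + length Ls"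
    using Cons.prems by (intro Cons.IH) (auto simp: length_wire_depths)
  then show ?case by (simp add: wire_depths_append)
qed (simp add: wire_depths_def)

lemma circuit_wf_layered:
  "layered n Ls \<Longrightarrow> out < n + length (concat Ls) \<Longrightarrow> circuit_wf n (concat Ls, out)"
  using layered_wf by (auto simp: circuit_wf_def)

lemma circuit_depth_layered: "layered n Ls \<Longrightarrow> circuit_depth n (concat Ls, out) \<le> length Ls"
  using layered_wire_depths[of "replicate n 0" Ls 0]
  by (auto simp: circuit_depth_def wire_depths_def[symmetric])

lemma circuit_output_wires: "circuit_output g (gs, out) x = wires g x gs ! out"
  by (simp add: circuit_output_def wires_def)

section \<open>The circuit around a single oracle query\<close>

definition literal_wires :: "nat \<Rightarrow> (nat \<Rightarrow> bool \<Rightarrow> bool) \<Rightarrow> nat list" where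
  "literal_wires m \<phi> = filter (\<lambda>l. \<phi> l True) [0..<m] @ map (\<lambda>l. m + l) (filter (\<lambda>l. \<phi> l False) [0..<m])"

definition equality_wires :: "nat \<Rightarrow> nat \<Rightarrow> nat \<Rightarrow> nat list" where
  "equality_wires n L v = map (\<lambda>j. if bit v j then n + j else n + L + j) [0..<L]"

text \<open>Wire layout: inputs from 0, their negations from \<open>m\<close>, the oracle's argument
  from \<open>2 * m\<close>, the answer bits from \<open>n\<close>, their negations from
  \<open>n + L\<close>, and from \<open>n + 2 * L\<close> one equality test for each accepted value,
  followed by their disjunction.\<close>

definition oracle_layers :: "nat \<Rightarrow> nat \<Rightarrow> nat \<Rightarrow> (nat \<Rightarrow> nat \<Rightarrow> bool \<Rightarrow> bool) \<Rightarrow> (nat \<Rightarrow> bool) \<Rightarrow> gate list list" where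
  "oracle_layers m P L \<phi> Q =
    (let n = 2 * m + P; vs = filter Q [0..<2 ^ L] in
     [map Not_Gate [0..<m],
      map (\<lambda>p. Or_Gate (literal_wires m (\<phi> p))) [0..<P],
      map (Oracle_Gate [2 * m..<n]) [0..<L],
      map Not_Gate [n..<n + L],
      map (\<lambda>v. And_Gate (equality_wires n L v)) vs,
      [Or_Gate [n + 2 * L..<n + 2 * L + length vs]]])"

lemma literal_wires_less: "w \<in> set (literal_wires m \<psi>) \<Longrightarrow> w < 2 * m"
  by (auto simp: literal_wires_def)

lemma equality_wires_less: "w \<in> set (equality_wires n L v) \<Longrightarrow> w < n + 2 * L"
  by (auto simp: equality_wires_def split: if_splits)

lemma layered_oracle_layers: "layered m (oracle_layers m P L \<phi> Q)"
  by (auto simp: oracle_layers_def Let_def fans_below_def literal_wires_def equality_wires_def)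

text \<open>The lists \<open>v1\<close> to \<open>v5\<close> are the wire values after each layer.
  Only \<open>L\<close> answer bits are read, hence the truncation by
  \<open>take_bit\<close>.\<close>

lemma wires_oracle_layers:
  fixes g m P L \<phi> Q x
  defines "a \<equiv> horner_sum of_bool 2 (g (map (\<lambda>p. \<exists>l<m. \<phi> p l (x ! l)) [0..<P])) :: nat"
  assumes x: "length x = m"
  shows "last (wires g x (concat (oracle_layers m P L \<phi> Q))) \<longleftrightarrow> Q (take_bit L a)"
proof -
  define n where "n = 2 * m + P"
  define vs where "vs = filter Q [0..<2 ^ L]"
  define pixels where "pixels = map (\<lambda>p. \<exists>l<m. \<phi> p l (x ! l)) [0..<P]"
  define bits where "bits = map (bit a) [0..<L]"
  define v1 where "v1 = x @ map Not x"
  define v2 where "v2 = v1 @ pixels"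
  define v3 where "v3 = v2 @ bits"
  define v4 where "v4 = v3 @ map Not bits"
  define v5 where "v5 = v4 @ map (\<lambda>v. v = take_bit L a) vs"
  have len: "length v1 = 2 * m" "length v2 = n" "length v3 = n + L" "length v4 = n + 2 * L"
    by (simp_all add: v1_def v2_def v3_def v4_def x pixels_def bits_def n_def)
  have w1: "wires g x (map Not_Gate [0..<m]) = v1"
    by (subst wires_layer) (auto simp: fans_below_def x v1_def intro!: nth_equalityI)
  have lit: "(\<exists>w\<in>set (literal_wires m \<psi>). v1 ! w) \<longleftrightarrow> (\<exists>l<m. \<psi> l (x ! l))" for \<psi>
  proof -
    have "(\<exists>w\<in>set (literal_wires m \<psi>). v1 ! w) \<longleftrightarrow>
        (\<exists>l<m. \<psi> l True \<and> v1 ! l) \<or> (\<exists>l<m. \<psi> l False \<and> v1 ! (m + l))"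
      by (auto simp: literal_wires_def)
    also have "\<dots> \<longleftrightarrow> (\<exists>l<m. \<psi> l True \<and> x ! l) \<or> (\<exists>l<m. \<psi> l False \<and> \<not> x ! l)"
      using x by (auto simp: v1_def nth_append)
    also have "\<dots> \<longleftrightarrow> (\<exists>l<m. \<psi> l (x ! l))" by (metis (full_types))
    finally show ?thesis .
  qed
  have w2: "wires g v1 (map (\<lambda>p. Or_Gate (literal_wires m (\<phi> p))) [0..<P]) = v2"
    by (subst wires_layer) (auto simp: fans_below_def len v2_def pixels_def lit dest: literal_wires_less)
  have arg: "map (\<lambda>w. v2 ! w) [2 * m..<n] = pixels"
    using len(1) by (auto simp: v2_def n_def pixels_def nth_append intro!: nth_equalityI)
  \<comment> \<open>Padding short answers with zeros agrees with the bits of the encoded number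
    beyond the length of its expansion.\<close>
  have w3: "wires g v2 (map (Oracle_Gate [2 * m..<n]) [0..<L]) = v3"
    by (subst wires_layer)
       (auto simp: fans_below_def len v3_def bits_def arg a_def[folded pixels_def] bit_horner_sum_bit_iff Let_def)
  have w4: "wires g v3 (map Not_Gate [n..<n + L]) = v4"
    by (subst wires_layer)
       (auto simp: fans_below_def len v4_def v3_def bits_def nth_append intro!: nth_equalityI)
  have eq: "(\<forall>w\<in>set (equality_wires n L v). v4 ! w) \<longleftrightarrow> v = take_bit L a" if "v \<in> set vs" for v
  proof -
    have "v4 ! (n + j) = bit a j" "v4 ! (n + L + j) = (\<not> bit a j)" if "j < L" for j
      using that len by (auto simp: v4_def v3_def nth_append bits_def)
    note v4_bits = this
    have "(\<forall>w\<in>set (equality_wires n L v). v4 ! w) \<longleftrightarrow> (\<forall>j<L. v4 ! (if bit v j then n + j else n + L + j))"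
      unfolding equality_wires_def set_map set_upt ball_simps(9) by (simp add: Ball_def)
    also have "\<dots> \<longleftrightarrow> (\<forall>j<L. bit v j = bit a j)" using v4_bits by auto
    also have "\<dots> \<longleftrightarrow> take_bit L v = take_bit L a"
      by (auto simp: bit_eq_iff bit_take_bit_iff)
    also have "take_bit L v = v" using that by (simp add: vs_def take_bit_nat_eq_self)
    finally show ?thesis .
  qed
  have w5: "wires g v4 (map (\<lambda>v. And_Gate (equality_wires n L v)) vs) = v5"
    by (subst wires_layer) (auto simp: fans_below_def len v5_def eq dest: equality_wires_less simp del: bex_simps ball_simps)
  have "wires g x (concat (oracle_layers m P L \<phi> Q)) =
      wires g v5 [Or_Gate [n + 2 * L..<n + 2 * L + length vs]]"
    unfolding oracle_layers_def Let_def n_def[symmetric] vs_def[symmetric]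
    by (simp only: concat.simps append_Nil2 wires_append w1 w2 w3 w4 w5)
  then have "last (wires g x (concat (oracle_layers m P L \<phi> Q))) \<longleftrightarrow>
      (\<exists>w\<in>{n + 2 * L..<n + 2 * L + length vs}. v5 ! w)"
    by (simp add: wires_def)
  also have "\<dots> \<longleftrightarrow> (\<exists>i<length vs. v5 ! (n + 2 * L + i))"
    by (metis (no_types, lifting) add_less_cancel_left atLeastLessThan_iff le_add1 le_iff_add)
  also have "\<dots> \<longleftrightarrow> take_bit L a \<in> set vs"
    using len by (auto simp: v5_def nth_append in_set_conv_nth)
  also have "\<dots> \<longleftrightarrow> Q (take_bit L a)" by (simp add: vs_def)
  finally show ?thesis .
qed

lemma sum_list_map_le: "(\<And>x. x \<in> set xs \<Longrightarrow> f x \<le> (b::nat)) \<Longrightarrow> sum_list (map f xs) \<le> length xs * b"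
  by (induction xs) (auto intro: add_mono)

text \<open>\<open>Q\<close> may be arbitrary, since it is tabulated over the \<open>2 ^ L\<close>
  values of the truncated answer. The summands of the size bound belong to the six layers in
  order.\<close>

lemma oracle_threshold_circuit:
  fixes \<phi> :: "nat \<Rightarrow> nat \<Rightarrow> bool \<Rightarrow> bool" and Q :: "nat \<Rightarrow> bool"
  obtains C where "circuit_wf m C" "circuit_depth m C \<le> 6"
    "circuit_size C \<le> 2 * m + P * (1 + 2 * m) + L * (1 + P) + 2 * L + 2 ^ L * (1 + L) + (1 + 2 ^ L)"
    "\<And>g x. length x = m \<Longrightarrow> circuit_output g C x =
       Q (take_bit L (horner_sum of_bool 2 (g (map (\<lambda>p. \<exists>l<m. \<phi> p l (x ! l)) [0..<P]))))"
proof
  define Ls where "Ls = oracle_layers m P L \<phi> Q"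
  define C where "C = (concat Ls, m + length (concat Ls) - 1)"
  have lay: "layered m Ls" unfolding Ls_def by (rule layered_oracle_layers)
  have ne: "concat Ls \<noteq> []" by (simp add: Ls_def oracle_layers_def Let_def)
  then show "circuit_wf m C" unfolding C_def by (intro circuit_wf_layered lay) (cases "concat Ls"; simp)
  show "circuit_depth m C \<le> 6"
  proof -
    have "length Ls = 6" by (simp add: Ls_def oracle_layers_def Let_def)
    then show ?thesis using circuit_depth_layered[OF lay] by (simp only: C_def)
  qed
  show "circuit_output g C x = Q (take_bit L (horner_sum of_bool 2 (g (map (\<lambda>p. \<exists>l<m. \<phi> p l (x ! l)) [0..<P]))))"
    if "length x = m" for g x
  proof -
    have "length (wires g x gs) = length x + length gs" for gs
      by (induction gs rule: rev_induct) (simp_all add: wires_def)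
    then have "circuit_output g C x = last (wires g x (concat Ls))"
      using ne that unfolding C_def circuit_output_wires
      by (subst last_conv_nth) (auto simp flip: length_greater_0_conv)
    then show ?thesis using wires_oracle_layers[OF that] by (simp add: Ls_def)
  qed
  let ?s = "\<lambda>G. 1 + length (fan_in G)"
  let ?vs = "filter Q [0..<2 ^ L]"
  have vs: "length ?vs \<le> 2 ^ L" using length_filter_le[of Q "[0..<2 ^ L]"] by simp
  have "length (literal_wires m \<psi>) \<le> 2 * m" for \<psi>
    using length_filter_le[of "\<lambda>l. \<psi> l True" "[0..<m]"] length_filter_le[of "\<lambda>l. \<psi> l False" "[0..<m]"]
    by (simp add: literal_wires_def)
  then have 2: "(\<Sum>p\<leftarrow>[0..<P]. 1 + length (literal_wires m (\<phi> p))) \<le> P * (1 + 2 * m)"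
    using sum_list_map_le[of "[0..<P]" "\<lambda>p. 1 + length (literal_wires m (\<phi> p))" "1 + 2 * m"] by simp
  have "(\<Sum>v\<leftarrow>?vs. 1 + length (equality_wires (2 * m + P) L v)) \<le> length ?vs * (1 + L)"
    by (intro sum_list_map_le) (simp add: equality_wires_def)
  also have "\<dots> \<le> 2 ^ L * (1 + L)" using vs by (intro mult_right_mono) auto
  finally have 5: "(\<Sum>v\<leftarrow>?vs. 1 + length (equality_wires (2 * m + P) L v)) \<le> 2 ^ L * (1 + L)" .
  have "circuit_size C = (\<Sum>l\<leftarrow>[0..<m]. 2) + (\<Sum>p\<leftarrow>[0..<P]. 1 + length (literal_wires m (\<phi> p))) +
     (\<Sum>j\<leftarrow>[0..<L]. 1 + P) + (\<Sum>j\<leftarrow>[2 * m + P..<2 * m + P + L]. 2) +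
     (\<Sum>v\<leftarrow>?vs. 1 + length (equality_wires (2 * m + P) L v)) + (1 + length ?vs)"
    unfolding C_def circuit_size_def Ls_def oracle_layers_def Let_def
    by (simp add: comp_def numeral_2_eq_2 del: sum_list_triv map_replicate_const sum_list_replicate)
  also have "\<dots> \<le> 2 * m + P * (1 + 2 * m) + L * (1 + P) + 2 * L + 2 ^ L * (1 + L) + (1 + 2 ^ L)"
    using 2 5 vs by (simp add: sum_list_triv)
  finally show "circuit_size C \<le> 2 * m + P * (1 + 2 * m) + L * (1 + P) + 2 * L + 2 ^ L * (1 + L) + (1 + 2 ^ L)" .
qed

section \<open>The reduction\<close>

text \<open>\<open>\<theta>\<close> sits on the logarithmic scale halfway between the counts
  \<open>t\<close> and \<open>t + 1\<close>. After the error of 1/10 a logarithmic gap of 2/5 of the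
  depth remains on either side; as the values are at least 1/2, half of it survives
  exponentiation.\<close>

lemma conformal_radius_dented_disc_threshold:
  fixes m t :: nat and X :: "nat set"
  assumes m: "m \<ge> 1" and X: "X \<subseteq> {..<m}" and t: "2 * t \<le> m"
  defines "r \<equiv> conformal_radius (dented_disc m X) 0"
    and "\<theta> \<equiv> exp (- dent_depth m * (real t + 1 / 2))"
  shows "card X \<le> t \<Longrightarrow> r \<ge> \<theta> + dent_depth m / 5"
    and "card X > t \<Longrightarrow> r \<le> \<theta> - dent_depth m / 5"
proof -
  let ?\<delta> = "dent_depth m"
  have \<delta>: "?\<delta> > 0" by (rule dent_depth_pos[OF m])
  have r: "1 / 2 \<le> r" using conformal_radius_dented_disc_bounds[OF m X] by (simp add: r_def)
  have est: "\<bar>ln r + ?\<delta> * real (card X)\<bar> \<le> ?\<delta> / 10"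
    using conformal_radius_dented_disc(2)[OF m X] by (simp add: r_def)
  have "?\<delta> * (real t + 1 / 2) \<le> ?\<delta> * real m" using t m \<delta> by (intro mult_left_mono) linarith+
  then have \<theta>: "1 / 2 \<le> \<theta>"
    using exp_ge_add_one_self[of "- ?\<delta> * (real t + 1 / 2)"] dent_depth_small[OF m]
    unfolding \<theta>_def by linarith
  have ln_\<theta>: "ln \<theta> = - (?\<delta> * real t) - ?\<delta> / 2" by (simp add: \<theta>_def algebra_simps)
  have gap: "y + ?\<delta> / 5 \<le> z" if "1 / 2 \<le> y" "0 < z" "ln y + 2 / 5 * ?\<delta> \<le> ln z" for y z
  proof -
    have "y * (1 + 2 / 5 * ?\<delta>) \<le> y * exp (2 / 5 * ?\<delta>)"
      using that exp_ge_add_one_self by (intro mult_left_mono) auto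
    also have "\<dots> = exp (ln y + 2 / 5 * ?\<delta>)" using that by (simp add: exp_add)
    also have "\<dots> \<le> z" using that by (metis exp_le_cancel_iff exp_ln)
    finally have "y + y * (2 / 5 * ?\<delta>) \<le> z" by (simp only: distrib_left mult_1_right)
    moreover have "1 / 2 * (2 / 5 * ?\<delta>) \<le> y * (2 / 5 * ?\<delta>)"
      using that \<delta> by (intro mult_right_mono) auto
    ultimately show ?thesis by linarith
  qed
  show "r \<ge> \<theta> + ?\<delta> / 5" if "card X \<le> t"
  proof (rule gap)
    have "?\<delta> * real (card X) \<le> ?\<delta> * real t" using that \<delta> by (intro mult_left_mono) auto
    then show "ln \<theta> + 2 / 5 * ?\<delta> \<le> ln r" using est ln_\<theta> by linarith
  qed (use \<theta> r in auto)
  show "r \<le> \<theta> - ?\<delta> / 5" if "card X > t"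
  proof -
    have "?\<delta> * (real t + 1) \<le> ?\<delta> * real (card X)" using that \<delta> by (intro mult_left_mono) auto
    then have "?\<delta> * real t + ?\<delta> \<le> ?\<delta> * real (card X)" by (simp add: distrib_left)
    then have "ln r + 2 / 5 * ?\<delta> \<le> ln \<theta>" using est ln_\<theta> by linarith
    then have "r + ?\<delta> / 5 \<le> \<theta>" using r \<theta> by (intro gap) auto
    then show ?thesis by simp
  qed
qed

text \<open>This is \<open>10 / dent_depth m\<close>.\<close>

definition resolution_base :: "nat \<Rightarrow> nat" where
  "resolution_base m = 6000 * 240 ^ 3 * m ^ 11"

text \<open>Let b = \<open>resolution_base m\<close> and let 2^k be the power of two above b^q and
  at most twice as large. Its power with exponent \<open>c\<close> is at least b^(q c), hence at
  least b, which is 10 divided by the depth.\<close>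

lemma ex_resolution:
  assumes m: "m \<ge> 1" and c: "0 < c" "c < 1 / 2" and q: "real q * c \<ge> 1"
  obtains k where "2 ^ k \<ge> (4096::nat)" "2 ^ k \<le> 2 * resolution_base m ^ q"
    "1 / (2 ^ k) powr c \<le> dent_depth m / 10"
proof -
  define b where "b = resolution_base m"
  have "b \<ge> 6000 * 240 ^ 3 * 1" unfolding b_def resolution_base_def using m by (intro mult_left_mono) auto
  then have b: "b \<ge> 4096" by simp
  have "q \<noteq> 0" using q by (intro notI) simp
  then have "b ^ 1 \<le> b ^ q" using b by (intro power_increasing) auto
  then have bq: "b \<le> b ^ q" by simp
  then obtain j where j: "2 ^ j \<le> b ^ q" "b ^ q < 2 ^ (j + 1)"
    using ex_power_ivl1[of 2 "b ^ q"] b by auto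
  show ?thesis
  proof (rule that)
    show "(4096::nat) \<le> 2 ^ (j + 1)" using j b bq by linarith
    show "2 ^ (j + 1) \<le> 2 * resolution_base m ^ q" using j by (simp add: b_def)
    have "real b powr 1 \<le> real b powr (real q * c)" using b q by (intro powr_mono) auto
    also have "\<dots> = (real b ^ q) powr c" using b by (simp add: powr_powr[symmetric] powr_realpow)
    also have "\<dots> \<le> (2 ^ (j + 1)) powr c"
    proof (intro powr_mono2)
      have "real (b ^ q) \<le> real (2 ^ (j + 1))" using j(2) by (simp only: of_nat_le_iff)
      then show "real b ^ q \<le> 2 ^ (j + 1)" by simp
    qed (use c in auto)
    finally have le: "real b \<le> (2 ^ (j + 1)) powr c" using b by simp
    have "10 / dent_depth m = real b"
      using m by (simp add: dent_depth_def margin_def b_def resolution_base_def field_simps)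
    then have "dent_depth m / 10 = 1 / real b" using dent_depth_pos[OF m] b by (simp add: field_simps)
    then show "1 / (2 ^ (j + 1)) powr c \<le> dent_depth m / 10"
      using le b by (simp add: frac_le)
  qed
qed

section \<open>Reading majority off the oracle's answer\<close>

lemma count_list_True: "count_list x True = card {i. i < length x \<and> x ! i}"
  by (simp add: count_list_eq_length_filter length_filter_conv_card)

text \<open>The answer is off by at most 1/10 of the depth, while the threshold is separated from
  the radius by 1/5 of it. More ones mean a smaller radius, hence the direction of the
  comparison.\<close>

lemma CONF_dent_string_decides_MAJ:
  assumes m: "m \<ge> 1" and M: "M \<ge> 1" and c: "0 < c" "c < 1 / 2"
    and k: "2 ^ k \<ge> (4096::nat)" "1 / (2 ^ k) powr c \<le> dent_depth m / 10"
    and x: "length x = m" and g: "solves g (CONF M c)"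
  defines "a \<equiv> horner_sum of_bool 2 (g (dent_string M k m {i. i < m \<and> x ! i})) :: nat"
  shows "a < 2 ^ (k + 3)"
    and "real a / 2 ^ k < exp (- dent_depth m * (real (m div 2) + 1 / 2)) \<longleftrightarrow> MAJ x"
proof -
  let ?X = "{i. i < m \<and> x ! i}" and ?\<delta> = "dent_depth m"
  let ?r = "conformal_radius (dented_disc m ?X) 0"
  have X: "?X \<subseteq> {..<m}" by auto
  have \<delta>: "?\<delta> > 0" by (rule dent_depth_pos[OF m])
  have "CONF M c (dent_string M k m ?X) (g (dent_string M k m ?X))"
    using CONF_dent_string(1)[OF m X M c k(1)] g unfolding solves_def by blast
  then have "\<bar>real a / 2 ^ k - ?r\<bar> \<le> 1 / (2 ^ k) powr c"
    unfolding a_def by (rule CONF_dent_string(2)[OF m X M c k(1)])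
  then have a: "\<bar>real a / 2 ^ k - ?r\<bar> \<le> ?\<delta> / 10" using k(2) by linarith
  have "?\<delta> * 1 \<le> ?\<delta> * real m" using m \<delta> by (intro mult_left_mono) auto
  \<comment> \<open>The radius is at most 2, so 8 = 2^3 leaves ample room and \<open>k + 3\<close>
    answer bits lose nothing.\<close>
  then have "real a / 2 ^ k < 8"
    using a dent_depth_small[OF m] conformal_radius_dented_disc_bounds[OF m X] by linarith
  then have "real a < real (2 ^ (k + 3))" by (simp add: field_simps power_add)
  then show "a < 2 ^ (k + 3)" by (simp only: of_nat_less_iff)
  have maj: "MAJ x \<longleftrightarrow> card ?X > m div 2"
    using x by (auto simp: MAJ_def count_list_True)
  have t: "2 * (m div 2) \<le> m" by simp
  show "real a / 2 ^ k < exp (- ?\<delta> * (real (m div 2) + 1 / 2)) \<longleftrightarrow> MAJ x"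
  proof (cases "card ?X \<le> m div 2")
    case True
    then show ?thesis
      using conformal_radius_dented_disc_threshold(1)[OF m X t True] a \<delta> maj by linarith
  next
    case False
    then have "card ?X > m div 2" by simp
    then show ?thesis
      using conformal_radius_dented_disc_threshold(2)[OF m X t] a \<delta> maj by linarith
  qed
qed

text \<open>The size bound of the circuit with 2^k and \<open>k\<close> both replaced by
  \<open>N\<close>, a polynomial bound for 2^k, and with \<open>P\<close> bounding the number of
  pixels.\<close>

definition size_poly :: "nat \<Rightarrow> nat \<Rightarrow> nat poly" where
  "size_poly M q =
    (let X = [:0, 1:]; N = [:2:] * ([:6000 * 240 ^ 3:] * X ^ 11) ^ q; P = ([:2 * M:] * N + 1)\<^sup>2 in
     [:2:] * X + P * (1 + [:2:] * X) + (N + [:3:]) * (1 + P) + [:2:] * (N + [:3:]) + [:8:] * N * (1 + (N + [:3:])) + (1 + [:8:] * N))"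

lemma MAJ_circuit:
  assumes c: "0 < c" "c < 1 / 2" and M: "M \<ge> 1" and q: "real q * c \<ge> 1"
  shows "\<exists>C. circuit_wf m C \<and> circuit_depth m C \<le> 6 \<and> circuit_size C \<le> poly (size_poly M q) m \<and>
    (\<forall>g x. solves g (CONF M c) \<longrightarrow> length x = m \<longrightarrow> circuit_output g C x = MAJ x)"
proof (cases "m = 0")
  case True
  \<comment> \<open>Dented discs require at least one dent. The empty string has no majority of
    ones, and an empty disjunction computes the constant 0.\<close>
  let ?C = "([Or_Gate []], 0) :: circuit"
  have "circuit_wf m ?C" "circuit_depth m ?C \<le> 6"
    by (simp_all add: circuit_wf_def circuit_depth_def True)
  moreover have "circuit_size ?C \<le> poly (size_poly M q) m"
    by (simp add: circuit_size_def size_poly_def Let_def)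
  moreover have "circuit_output g ?C x = MAJ x" if "length x = m" for g x
    using that True by (simp add: circuit_output_def MAJ_def)
  ultimately show ?thesis by blast
next
  case False
  then have m: "m \<ge> 1" by simp
  obtain k where k: "2 ^ k \<ge> (4096::nat)" "2 ^ k \<le> 2 * resolution_base m ^ q"
    "1 / (2 ^ k) powr c \<le> dent_depth m / 10"
    using ex_resolution[OF m c q] by blast
  define W where "W = 2 * M * 2 ^ k + 1"
  define \<phi> where "\<phi> = (\<lambda>p. dent_literal m k (int (p div W) - int (M * 2 ^ k)) (int (p mod W) - int (M * 2 ^ k)))"
  define Q where "Q a \<longleftrightarrow> real a / 2 ^ k < exp (- dent_depth m * (real (m div 2) + 1 / 2))" for a :: nat
  obtain C where C: "circuit_wf m C" "circuit_depth m C \<le> 6"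
    "circuit_size C \<le> 2 * m + W\<^sup>2 * (1 + 2 * m) + (k + 3) * (1 + W\<^sup>2) + 2 * (k + 3) + 2 ^ (k + 3) * (1 + (k + 3)) + (1 + 2 ^ (k + 3))"
    "\<And>g x. length x = m \<Longrightarrow> circuit_output g C x =
       Q (take_bit (k + 3) (horner_sum of_bool 2 (g (map (\<lambda>p. \<exists>l<m. \<phi> p l (x ! l)) [0..<W\<^sup>2]))))"
    by (rule oracle_threshold_circuit[where m = m and P = "W\<^sup>2" and L = "k + 3" and \<phi> = \<phi> and Q = Q])
      (rule that; assumption)
  have "circuit_output g C x = MAJ x" if g: "solves g (CONF M c)" and x: "length x = m" for g x
  proof -
    let ?X = "{i. i < m \<and> x ! i}"
    \<comment> \<open>The disjunctions of literals wired into the circuit produce the pixel string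
      of the disc dented at the ones of \<open>x\<close>.\<close>
    have "map (\<lambda>p. \<exists>l<m. \<phi> p l (x ! l)) [0..<W\<^sup>2] = dent_string M k m ?X"
      unfolding dent_string_def W_def[symmetric]
    proof (intro map_cong refl)
      fix p
      show "(\<exists>l<m. \<phi> p l (x ! l)) =
          dent_pixel m ?X k (int (p div W) - int (M * 2 ^ k)) (int (p mod W) - int (M * 2 ^ k))"
        by (subst dent_pixel_iff_literal[OF m]) (auto simp: \<phi>_def)
    qed
    then show ?thesis
      using C(4)[OF x, of g] CONF_dent_string_decides_MAJ[OF m M c k(1,3) x g]
      by (simp add: Q_def take_bit_nat_eq_self)
  qed
  moreover have "circuit_size C \<le> poly (size_poly M q) m"
  proof -
    define N where "N = 2 * resolution_base m ^ q"
    have kN: "k \<le> N" using k(2) less_exp[of k] unfolding N_def by linarith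
    have WN: "W \<le> 2 * M * N + 1"
      unfolding W_def using k(2) by (intro add_mono mult_left_mono) (auto simp: N_def)
    have W2: "W\<^sup>2 \<le> (2 * M * N + 1)\<^sup>2" using WN by (intro power_mono) auto
    have pN: "2 ^ (k + 3) \<le> 8 * N" using k(2) by (simp add: power_add N_def)
    note C(3)
    also have "2 * m + W\<^sup>2 * (1 + 2 * m) + (k + 3) * (1 + W\<^sup>2) + 2 * (k + 3) + 2 ^ (k + 3) * (1 + (k + 3)) + (1 + 2 ^ (k + 3))
      \<le> 2 * m + (2 * M * N + 1)\<^sup>2 * (1 + 2 * m) + (N + 3) * (1 + (2 * M * N + 1)\<^sup>2) + 2 * (N + 3) + 8 * N * (1 + (N + 3)) + (1 + 8 * N)"
      using kN W2 pN by (intro add_mono mult_mono le_refl) auto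
    also have "\<dots> = poly (size_poly M q) m"
      by (simp add: size_poly_def Let_def N_def resolution_base_def mult_ac)
    finally show ?thesis .
  qed
  ultimately show ?thesis using C(1,2) by blast
qed

theorem theorem1p11:
  fixes c :: real and M :: nat
  assumes "0 < c" and "c < 1 / 2" and "M \<ge> 1"
  shows "ac0_reducible MAJ (CONF M c)"
proof -
  \<comment> \<open>\<open>q\<close> depends on \<open>c\<close> alone, so one polynomial bounds the
    circuit sizes for all input lengths.\<close>
  define q where "q = nat \<lceil>1 / c\<rceil>"
  have "1 / c \<le> real q" unfolding q_def by (rule real_nat_ceiling_ge)
  then have "real q * c \<ge> 1" using assms(1) by (simp add: field_simps)
  then obtain C where "\<And>m. circuit_wf m (C m) \<and> circuit_depth m (C m) \<le> 6 \<and>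
      circuit_size (C m) \<le> poly (size_poly M q) m \<and>
      (\<forall>g x. solves g (CONF M c) \<longrightarrow> length x = m \<longrightarrow> circuit_output g (C m) x = MAJ x)"
    using MAJ_circuit[OF assms(1,2,3)] by metis
  then show ?thesis unfolding ac0_reducible_def by blast
qed

end
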